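(* Let $\mathfrak g$ be a finite-dimensional Lie algebra over a field $\mathbb K$ of characteristic zero, $G$ a $\mathfrak g$-module, and $V=(V^\bullet,d^V)$ a resolution of $G$. For every Loday–Pirashvili module $(G,X)$ over $\mathfrak g$, there exists a unique dg Loday–Pirashvili class $(V,[\alpha])$ which is a dg lift of $(G,X)$.
   Context: A dg $\mathfrak g$-module is a bounded cochain complex $(V^\bullet,d^V)$ of $\mathfrak g$-modules with $\mathfrak g$-equivariant differentials. $V$ is a resolution of $G$ if $V^i=0$ for $i<0$, $G\cong\ker d^V_0$ as $\mathfrak g$-modules, and $\ker d^V_i=\mathrm{im}\,d^V_{i-1}$ for $i\ge1$. A Loday–Pirashvili module $(G,X)$ is a $\mathfrak g$-module $G$ with a linear map $X\colon G\to\mathfrak g$ satisfying $X(x\triangleright g)=[x,X(g)]$; a morphism $(G,X)\to(H,Y)$ is a $\mathfrak g$-module map $\varphi$ with $Y\circ\varphi=X$. For a dg $\mathfrak g$-module $W$, $\Omega_{\mathfrak g}(W)=\wedge^\bullet\mathfrak g^\vee\otimes W$ (degree $p+q$ on $\wedge^p\mathfrak g^\vee\otimes W^q$) with total differential $d^W_{\mathrm{tot}}=d^W_{\mathrm{CE}}+d^W$, $d^W_{\mathrm{CE}}$ the Chevalley–Eilenberg differential and $d^W(\omega\otimes w)=(-1)^p\omega\otimes d^Ww$. A dg Loday–Pirashvili module is a pair $(V,\alpha)$ with $V$ a non-negative bounded dg $\mathfrak g$-module and $\alpha\colon\Omega_{\mathfrak g}(V)\to\Omega_{\mathfrak g}(\mathfrak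 g)$ a degree $0$ $\Omega_{\mathfrak g}$-linear map with $\alpha\circ d^V_{\mathrm{tot}}=d^{\mathfrak g}_{\mathrm{CE}}\circ\alpha$ (here $\mathfrak g$ is in degree $0$ with the adjoint action); its component $V^0\to\mathfrak g$ is denoted $\alpha_0$. Two such $\alpha,\alpha'$ on $V$ are homotopic if $\alpha'-\alpha=d^{\mathfrak g}_{\mathrm{CE}}\circ h+h\circ d^V_{\mathrm{tot}}$ for a degree $-1$ $\Omega_{\mathfrak g}$-linear $h$; a dg Loday–Pirashvili class $(V,[\alpha])$ is $V$ together with the homotopy class of $\alpha$. Its image under $\mathbf H^0$ is the Loday–Pirashvili module $(\mathbf H^0(V),\mathbf H^0(\alpha))$ where $\mathbf H^0(V)=\ker d^V_0$ and $\mathbf H^0(\alpha)=\alpha_0|_{\ker d^V_0}$ (independent of the representative). A dg lift of $(G,X)$ is a dg Loday–Pirashvili class $(V,[\alpha])$ such that $(\mathbf H^0(V),\mathbf H^0(\alpha))\cong(G,X)$ as Loday–Pirashvili modules.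
   Formalization: A dg lift is taken relative to the fixed identification of G with ker d_0 that comes with the resolution (α_0 restricted to G equals X); with an arbitrary isomorphism (H^0(V),H^0(α)) ≅ (G,X) uniqueness fails, e.g. g=G=V=K abelian, X=id, where id and 2·id are both lifts. *)

theory Defs
  imports Complex_Main "HOL-Combinatorics.Permutations"
begin

text \<open>Conventions. The ground field is a type 'a of class field_char_0.
 A vector space is a type with a scalar multiplication satisfying vector_space.
 Graded objects V = (V^q)_{q \<ge> 0} are modelled by subspaces Vc q of one ambient type.
 Elements of Omega_g(W) = (wedge^p g^dual tensor W^q)_{p,q} are modelled (g finite-dimensional)
 as families c p q of alternating p-linear maps g^p \<rightarrow> W^q (arguments given as lists of length p).\<close>

definition sgnp :: "nat \<Rightarrow> 'w::ab_group_add \<Rightarrow> 'w" where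
  "sgnp i w = (if even i then w else - w)"

definition rem_nth :: "nat \<Rightarrow> 'x list \<Rightarrow> 'x list" where
  "rem_nth i xs = take i xs @ drop (Suc i) xs"

definition lin_on :: "('a::field \<Rightarrow> 'b::ab_group_add \<Rightarrow> 'b) \<Rightarrow> ('a \<Rightarrow> 'c::ab_group_add \<Rightarrow> 'c)
    \<Rightarrow> 'b set \<Rightarrow> ('b \<Rightarrow> 'c) \<Rightarrow> bool" where
  "lin_on s1 s2 A f \<longleftrightarrow> (\<forall>x\<in>A. \<forall>y\<in>A. \<forall>a. f (s1 a x + y) = s2 a (f x) + f y)"

definition lie_algebra :: "('a::field \<Rightarrow> 'g::ab_group_add \<Rightarrow> 'g) \<Rightarrow> ('g \<Rightarrow> 'g \<Rightarrow> 'g) \<Rightarrow> bool" where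
  "lie_algebra sg br \<longleftrightarrow> vector_space sg
     \<and> (\<forall>x. lin_on sg sg UNIV (br x)) \<and> (\<forall>y. lin_on sg sg UNIV (\<lambda>x. br x y))
     \<and> (\<forall>x. br x x = 0)
     \<and> (\<forall>x y z. br x (br y z) + br y (br z x) + br z (br x y) = 0)"

definition fd_lie_algebra :: "('a::field \<Rightarrow> 'g::ab_group_add \<Rightarrow> 'g) \<Rightarrow> ('g \<Rightarrow> 'g \<Rightarrow> 'g) \<Rightarrow> bool" where
  "fd_lie_algebra sg br \<longleftrightarrow> lie_algebra sg br \<and> (\<exists>B. finite_dimensional_vector_space sg B)"

definition lie_module_on :: "('a::field \<Rightarrow> 'g::ab_group_add \<Rightarrow> 'g) \<Rightarrow> ('g \<Rightarrow> 'g \<Rightarrow> 'g)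
    \<Rightarrow> ('a \<Rightarrow> 'w::ab_group_add \<Rightarrow> 'w) \<Rightarrow> ('g \<Rightarrow> 'w \<Rightarrow> 'w) \<Rightarrow> 'w set \<Rightarrow> bool" where
  "lie_module_on sg br sw act W \<longleftrightarrow> vector_space sw \<and> module.subspace sw W
     \<and> (\<forall>x. \<forall>w\<in>W. act x w \<in> W)
     \<and> (\<forall>w\<in>W. lin_on sg sw UNIV (\<lambda>x. act x w))
     \<and> (\<forall>x. lin_on sw sw W (act x))
     \<and> (\<forall>x y. \<forall>w\<in>W. act (br x y) w = act x (act y w) - act y (act x w))"

definition dg_module :: "('a::field \<Rightarrow> 'g::ab_group_add \<Rightarrow> 'g) \<Rightarrow> ('g \<Rightarrow> 'g \<Rightarrow> 'g)
    \<Rightarrow> ('a \<Rightarrow> 'v::ab_group_add \<Rightarrow> 'v) \<Rightarrow> ('g \<Rightarrow> 'v \<Rightarrow> 'v) \<Rightarrow> (nat \<Rightarrow> 'v set)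
    \<Rightarrow> (nat \<Rightarrow> 'v \<Rightarrow> 'v) \<Rightarrow> bool" where
  "dg_module sg br sv act Vc d \<longleftrightarrow>
     (\<forall>q. lie_module_on sg br sv act (Vc q))
     \<and> (\<forall>q. lin_on sv sv (Vc q) (d q))
     \<and> (\<forall>q. \<forall>v\<in>Vc q. d q v \<in> Vc (Suc q))
     \<and> (\<forall>q x. \<forall>v\<in>Vc q. d q (act x v) = act x (d q v))
     \<and> (\<forall>q. \<forall>v\<in>Vc q. d (Suc q) (d q v) = 0)
     \<and> (\<exists>N. \<forall>q>N. Vc q = {0})"

definition resolution :: "('a::field \<Rightarrow> 'g::ab_group_add \<Rightarrow> 'g) \<Rightarrow> ('g \<Rightarrow> 'g \<Rightarrow> 'g)
    \<Rightarrow> ('a \<Rightarrow> 'v::ab_group_add \<Rightarrow> 'v) \<Rightarrow> ('g \<Rightarrow> 'v \<Rightarrow> 'v) \<Rightarrow> (nat \<Rightarrow> 'v set)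
    \<Rightarrow> (nat \<Rightarrow> 'v \<Rightarrow> 'v) \<Rightarrow> ('a \<Rightarrow> 'm::ab_group_add \<Rightarrow> 'm) \<Rightarrow> ('g \<Rightarrow> 'm \<Rightarrow> 'm)
    \<Rightarrow> ('m \<Rightarrow> 'v) \<Rightarrow> bool" where
  "resolution sg br sv act Vc d sm actm iota \<longleftrightarrow>
     dg_module sg br sv act Vc d
     \<and> lin_on sm sv UNIV iota \<and> inj iota
     \<and> (\<forall>x m. iota (actm x m) = act x (iota m))
     \<and> range iota = {v \<in> Vc 0. d 0 v = 0}
     \<and> (\<forall>q. {v \<in> Vc (Suc q). d (Suc q) v = 0} = d q ` Vc q)"

definition LP_module :: "('a::field \<Rightarrow> 'g::ab_group_add \<Rightarrow> 'g) \<Rightarrow> ('g \<Rightarrow> 'g \<Rightarrow> 'g)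
    \<Rightarrow> ('a \<Rightarrow> 'm::ab_group_add \<Rightarrow> 'm) \<Rightarrow> ('g \<Rightarrow> 'm \<Rightarrow> 'm) \<Rightarrow> ('m \<Rightarrow> 'g) \<Rightarrow> bool" where
  "LP_module sg br sm actm X \<longleftrightarrow> lie_module_on sg br sm actm UNIV
     \<and> lin_on sm sg UNIV X \<and> (\<forall>x m. X (actm x m) = br x (X m))"

definition alt_map :: "('a::field \<Rightarrow> 'g::ab_group_add \<Rightarrow> 'g) \<Rightarrow> ('a \<Rightarrow> 'w::ab_group_add \<Rightarrow> 'w)
    \<Rightarrow> 'w set \<Rightarrow> nat \<Rightarrow> ('g list \<Rightarrow> 'w) \<Rightarrow> bool" where
  "alt_map sg sw W p f \<longleftrightarrow>
     (\<forall>xs. length xs \<noteq> p \<longrightarrow> f xs = 0)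
     \<and> (\<forall>xs. length xs = p \<longrightarrow> f xs \<in> W)
     \<and> (\<forall>xs i a y z. length xs = p \<and> i < p \<longrightarrow>
           f (xs[i := sg a y + z]) = sw a (f (xs[i := y])) + f (xs[i := z]))
     \<and> (\<forall>xs i j. length xs = p \<and> i < j \<and> j < p \<and> xs ! i = xs ! j \<longrightarrow> f xs = 0)"

definition Omega :: "('a::field \<Rightarrow> 'g::ab_group_add \<Rightarrow> 'g) \<Rightarrow> ('a \<Rightarrow> 'w::ab_group_add \<Rightarrow> 'w)
    \<Rightarrow> (nat \<Rightarrow> 'w set) \<Rightarrow> (nat \<Rightarrow> nat \<Rightarrow> 'g list \<Rightarrow> 'w) set" where
  "Omega sg sw Wc = {c. \<forall>p q. alt_map sg sw (Wc q) p (c p q)}"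

definition OmegaK :: "('a::field \<Rightarrow> 'g::ab_group_add \<Rightarrow> 'g) \<Rightarrow> (nat \<Rightarrow> 'g list \<Rightarrow> 'a) set" where
  "OmegaK sg = {eta. \<forall>r. alt_map sg (*) UNIV r (eta r)}"

definition gcar :: "nat \<Rightarrow> 'g::zero set" where
  "gcar q = (if q = 0 then UNIV else {0})"

definition oadd :: "(nat \<Rightarrow> nat \<Rightarrow> 'g list \<Rightarrow> 'w::ab_group_add) \<Rightarrow> (nat \<Rightarrow> nat \<Rightarrow> 'g list \<Rightarrow> 'w)
    \<Rightarrow> (nat \<Rightarrow> nat \<Rightarrow> 'g list \<Rightarrow> 'w)" where
  "oadd c c' = (\<lambda>p q xs. c p q xs + c' p q xs)"

definition osub :: "(nat \<Rightarrow> nat \<Rightarrow> 'g list \<Rightarrow> 'w::ab_group_add) \<Rightarrow> (nat \<Rightarrow> nat \<Rightarrow> 'g list \<Rightarrow> 'w)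
    \<Rightarrow> (nat \<Rightarrow> nat \<Rightarrow> 'g list \<Rightarrow> 'w)" where
  "osub c c' = (\<lambda>p q xs. c p q xs - c' p q xs)"

definition dCE :: "('g \<Rightarrow> 'g \<Rightarrow> 'g) \<Rightarrow> ('g \<Rightarrow> 'w::ab_group_add \<Rightarrow> 'w)
    \<Rightarrow> (nat \<Rightarrow> nat \<Rightarrow> 'g list \<Rightarrow> 'w) \<Rightarrow> (nat \<Rightarrow> nat \<Rightarrow> 'g list \<Rightarrow> 'w)" where
  "dCE br act c = (\<lambda>p q xs. if p = 0 \<or> length xs \<noteq> p then 0 else
      (\<Sum>i<p. sgnp i (act (xs ! i) (c (p - 1) q (rem_nth i xs))))
    + (\<Sum>j<p. \<Sum>i<j. sgnp (i + j)
          (c (p - 1) q (br (xs ! i) (xs ! j) # rem_nth i (rem_nth j xs)))))"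

text \<open>Internal differential d^W(omega tensor w) = (-1)^p omega tensor d w.\<close>
definition dW :: "(nat \<Rightarrow> 'w::ab_group_add \<Rightarrow> 'w)
    \<Rightarrow> (nat \<Rightarrow> nat \<Rightarrow> 'g list \<Rightarrow> 'w) \<Rightarrow> (nat \<Rightarrow> nat \<Rightarrow> 'g list \<Rightarrow> 'w)" where
  "dW d c = (\<lambda>p q xs. if q = 0 \<or> length xs \<noteq> p then 0 else sgnp p (d (q - 1) (c p (q - 1) xs)))"

definition dtot :: "('g \<Rightarrow> 'g \<Rightarrow> 'g) \<Rightarrow> ('g \<Rightarrow> 'w::ab_group_add \<Rightarrow> 'w) \<Rightarrow> (nat \<Rightarrow> 'w \<Rightarrow> 'w)
    \<Rightarrow> (nat \<Rightarrow> nat \<Rightarrow> 'g list \<Rightarrow> 'w) \<Rightarrow> (nat \<Rightarrow> nat \<Rightarrow> 'g list \<Rightarrow> 'w)" where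
  "dtot br act d c = oadd (dCE br act c) (dW d c)"

definition shuffles :: "nat \<Rightarrow> nat \<Rightarrow> (nat \<Rightarrow> nat) set" where
  "shuffles r s = {\<sigma>. \<sigma> permutes {0..<r + s}
      \<and> (\<forall>i j. i < j \<and> j < r \<longrightarrow> \<sigma> i < \<sigma> j)
      \<and> (\<forall>i j. r \<le> i \<and> i < j \<and> j < r + s \<longrightarrow> \<sigma> i < \<sigma> j)}"

definition wedge :: "('a::comm_ring_1 \<Rightarrow> 'w::ab_group_add \<Rightarrow> 'w) \<Rightarrow> (nat \<Rightarrow> 'g list \<Rightarrow> 'a)
    \<Rightarrow> (nat \<Rightarrow> nat \<Rightarrow> 'g list \<Rightarrow> 'w) \<Rightarrow> (nat \<Rightarrow> nat \<Rightarrow> 'g list \<Rightarrow> 'w)" where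
  "wedge sw eta c = (\<lambda>p q xs. if length xs \<noteq> p then 0 else
     (\<Sum>r\<in>{0..p}. \<Sum>\<sigma>\<in>shuffles r (p - r).
        sw (of_int (sign \<sigma>) * eta r (map (\<lambda>k. xs ! \<sigma> k) [0..<r]))
           (c (p - r) q (map (\<lambda>k. xs ! \<sigma> k) [r..<p]))))"

definition par :: "(nat \<Rightarrow> 'g list \<Rightarrow> 'a::ring_1) \<Rightarrow> (nat \<Rightarrow> 'g list \<Rightarrow> 'a)" where
  "par eta = (\<lambda>r xs. if even r then eta r xs else - eta r xs)"

definition hom_deg :: "int \<Rightarrow> (nat \<Rightarrow> nat \<Rightarrow> 'g list \<Rightarrow> 'w::zero) \<Rightarrow> bool" where
  "hom_deg n c \<longleftrightarrow> (\<forall>p q. int p + int q \<noteq> n \<longrightarrow> c p q = (\<lambda>_. 0))"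

text \<open>Omega_g-linear maps of degree k from Omega_g(W) to Omega_g(W') (Koszul sign (-1)^(k r)).\<close>
definition omega_map :: "('a::field \<Rightarrow> 'g::ab_group_add \<Rightarrow> 'g) \<Rightarrow> ('a \<Rightarrow> 'w::ab_group_add \<Rightarrow> 'w)
    \<Rightarrow> ('a \<Rightarrow> 'u::ab_group_add \<Rightarrow> 'u) \<Rightarrow> (nat \<Rightarrow> 'w set) \<Rightarrow> (nat \<Rightarrow> 'u set) \<Rightarrow> int
    \<Rightarrow> ((nat \<Rightarrow> nat \<Rightarrow> 'g list \<Rightarrow> 'w) \<Rightarrow> (nat \<Rightarrow> nat \<Rightarrow> 'g list \<Rightarrow> 'u)) \<Rightarrow> bool" where
  "omega_map sg sw su Wc Uc k F \<longleftrightarrow>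
     (\<forall>c\<in>Omega sg sw Wc. F c \<in> Omega sg su Uc)
     \<and> (\<forall>c\<in>Omega sg sw Wc. \<forall>c'\<in>Omega sg sw Wc. F (oadd c c') = oadd (F c) (F c'))
     \<and> (\<forall>eta\<in>OmegaK sg. \<forall>c\<in>Omega sg sw Wc.
          F (wedge sw eta c) = wedge su (if even k then eta else par eta) (F c))
     \<and> (\<forall>n. \<forall>c\<in>Omega sg sw Wc. hom_deg n c \<longrightarrow> hom_deg (n + k) (F c))"

definition dg_LP :: "('a::field \<Rightarrow> 'g::ab_group_add \<Rightarrow> 'g) \<Rightarrow> ('g \<Rightarrow> 'g \<Rightarrow> 'g)
    \<Rightarrow> ('a \<Rightarrow> 'v::ab_group_add \<Rightarrow> 'v) \<Rightarrow> ('g \<Rightarrow> 'v \<Rightarrow> 'v) \<Rightarrow> (nat \<Rightarrow> 'v set)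
    \<Rightarrow> (nat \<Rightarrow> 'v \<Rightarrow> 'v)
    \<Rightarrow> ((nat \<Rightarrow> nat \<Rightarrow> 'g list \<Rightarrow> 'v) \<Rightarrow> (nat \<Rightarrow> nat \<Rightarrow> 'g list \<Rightarrow> 'g)) \<Rightarrow> bool" where
  "dg_LP sg br sv act Vc d alpha \<longleftrightarrow> dg_module sg br sv act Vc d
     \<and> omega_map sg sv sg Vc gcar 0 alpha
     \<and> (\<forall>c\<in>Omega sg sv Vc. alpha (dtot br act d c) = dCE br br (alpha c))"

definition homotopic :: "('a::field \<Rightarrow> 'g::ab_group_add \<Rightarrow> 'g) \<Rightarrow> ('g \<Rightarrow> 'g \<Rightarrow> 'g)
    \<Rightarrow> ('a \<Rightarrow> 'v::ab_group_add \<Rightarrow> 'v) \<Rightarrow> ('g \<Rightarrow> 'v \<Rightarrow> 'v) \<Rightarrow> (nat \<Rightarrow> 'v set)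
    \<Rightarrow> (nat \<Rightarrow> 'v \<Rightarrow> 'v)
    \<Rightarrow> ((nat \<Rightarrow> nat \<Rightarrow> 'g list \<Rightarrow> 'v) \<Rightarrow> (nat \<Rightarrow> nat \<Rightarrow> 'g list \<Rightarrow> 'g))
    \<Rightarrow> ((nat \<Rightarrow> nat \<Rightarrow> 'g list \<Rightarrow> 'v) \<Rightarrow> (nat \<Rightarrow> nat \<Rightarrow> 'g list \<Rightarrow> 'g)) \<Rightarrow> bool" where
  "homotopic sg br sv act Vc d alpha alpha' \<longleftrightarrow>
     (\<exists>h. omega_map sg sv sg Vc gcar (-1) h
        \<and> (\<forall>c\<in>Omega sg sv Vc.
             osub (alpha' c) (alpha c) = oadd (dCE br br (h c)) (h (dtot br act d c))))"

definition emb0 :: "'v::zero \<Rightarrow> (nat \<Rightarrow> nat \<Rightarrow> 'g list \<Rightarrow> 'v)" where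
  "emb0 v = (\<lambda>p q xs. if p = 0 \<and> q = 0 \<and> xs = [] then v else 0)"

definition alpha0 :: "((nat \<Rightarrow> nat \<Rightarrow> 'g list \<Rightarrow> 'v::zero) \<Rightarrow> (nat \<Rightarrow> nat \<Rightarrow> 'g list \<Rightarrow> 'g))
    \<Rightarrow> 'v \<Rightarrow> 'g" where
  "alpha0 alpha v = alpha (emb0 v) 0 0 []"

text \<open>(V,[alpha]) is a dg lift of (G,X): H^0(alpha) corresponds to X under G \<cong> ker d_0 = H^0(V).\<close>
definition dg_lift :: "('a::field \<Rightarrow> 'g::ab_group_add \<Rightarrow> 'g) \<Rightarrow> ('g \<Rightarrow> 'g \<Rightarrow> 'g)
    \<Rightarrow> ('a \<Rightarrow> 'v::ab_group_add \<Rightarrow> 'v) \<Rightarrow> ('g \<Rightarrow> 'v \<Rightarrow> 'v) \<Rightarrow> (nat \<Rightarrow> 'v set)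
    \<Rightarrow> (nat \<Rightarrow> 'v \<Rightarrow> 'v) \<Rightarrow> ('m \<Rightarrow> 'v) \<Rightarrow> ('m \<Rightarrow> 'g)
    \<Rightarrow> ((nat \<Rightarrow> nat \<Rightarrow> 'g list \<Rightarrow> 'v) \<Rightarrow> (nat \<Rightarrow> nat \<Rightarrow> 'g list \<Rightarrow> 'g)) \<Rightarrow> bool" where
  "dg_lift sg br sv act Vc d iota X alpha \<longleftrightarrow>
     dg_LP sg br sv act Vc d alpha \<and> (\<forall>m. alpha0 alpha (iota m) = X m)"

end

theory Submission
  imports Defs "Jordan_Normal_Form.Determinant"
begin

text \<open>Over the field \<open>\<K>\<close> the resolution has a linear contraction \<open>s\<close>, which extends to an
  \<open>\<Omega>\<close>-linear operator \<open>S\<close> of degree \<open>-1\<close>. The chain map \<open>P = 1 - (d S + S d)\<close> is \<open>\<Omega>\<close>-linear and,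
  since \<open>d s + s d = 1\<close> above degree \<open>0\<close>, equals the projection onto \<open>ker d\<^sub>0\<close> in degree \<open>0\<close> minus wedging with
  the 1-form \<open>x \<mapsto> [x, s]\<close>, which lowers the degree in \<open>V\<close>. As \<open>V\<close> is bounded, a power \<open>P\<^sup>n\<close> maps
  \<open>\<Omega>(V)\<close> into \<open>\<Omega>(ker d\<^sub>0)\<close>. Composing it with \<open>X\<close> gives a lift. Any \<open>\<alpha>\<close> is homotopic to
  \<open>\<alpha> P\<^sup>n\<close>, which only depends on the restriction of \<open>\<alpha>\<close> to \<open>\<Omega>(ker d\<^sub>0)\<close>, hence on its values
  on \<open>ker d\<^sub>0\<close> itself.

  A family of \<open>p\<close>-linear maps, \<open>p \<ge> 0\<close>, is encoded as a single function on lists. In this form both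
  the differential and the wedge product satisfy recursions on the first argument
  (\<open>\<iota>\<^sub>x d = L\<^sub>x - d \<iota>\<^sub>x\<close> and the Leibniz rule for \<open>\<iota>\<^sub>x\<close>), from which all identities follow
  by list induction.\<close>

section \<open>Alternating cochains and Cartan operators\<close>

text \<open>The obstacle is that exactness only provides a linear \<open>s\<close>, in general no
  equivariant one. So \<open>S\<close> need not anticommute with the Chevalley-Eilenberg
  differential, and \<open>P\<close> is a projection perturbed by the commutators [x, s]. If
  \<open>V\<close> vanishes above degree N, then N applications of \<open>P\<close> clear all
  positive degrees of \<open>V\<close>, and one more applies 1 - s d in degree 0, which lands in ker
  d_0; hence the exponent N + 1 below. Composition with X is a chain map only after this step: X is
  equivariant on ker d_0, its linear extension to V^0 in general is not. Uniqueness rests on the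
  fact that ker d_0 generates \<Omega>(ker d_0) over the forms. With a finite basis b and dual basis
  e^b, Euler's identity writes a cochain c of form degree p > 0 as 1/p times the sum of e^b wedge
  i_b c, where i_b is contraction with b. Dividing by p is where characteristic zero enters, and the
  finite basis makes this a finite sum, to which additivity and compatibility with wedge products
  apply.\<close>

definition contract :: "'g \<Rightarrow> ('g list \<Rightarrow> 'w) \<Rightarrow> 'g list \<Rightarrow> 'w" where
  "contract x f = (\<lambda>ys. f (x # ys))"

text \<open>The parity involution, (-1)^p on forms of degree p. It carries every Koszul sign that
  arises when an odd operator passes a form.\<close>

definition sgnlen :: "('g list \<Rightarrow> 'w::ab_group_add) \<Rightarrow> 'g list \<Rightarrow> 'w" where
  "sgnlen f = (\<lambda>xs. sgnp (length xs) (f xs))"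

text \<open>Both factors may be inhomogeneous: on a list of length p the recursion collects all
  splittings into r and p - r arguments.\<close>

fun lwedge :: "('a \<Rightarrow> 'w \<Rightarrow> 'w) \<Rightarrow> ('g list \<Rightarrow> 'a::ab_group_add) \<Rightarrow> ('g list \<Rightarrow> 'w::ab_group_add)
    \<Rightarrow> 'g list \<Rightarrow> 'w" where
  "lwedge sw e f [] = sw (e []) (f [])"
| "lwedge sw e f (x # xs) = lwedge sw (contract x e) f xs + lwedge sw (sgnlen e) (contract x f) xs"

lemma contract_apply: "contract x f ys = f (x # ys)"
  by (simp add: contract_def)

lemma sgnp_simps [simp]:
  "sgnp 0 w = w" "sgnp (Suc n) w = - sgnp n w" "sgnp n (sgnp n w) = w" "sgnp n (0::'w::ab_group_add) = 0"
  "sgnp n (- w) = - sgnp n w"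
  for w :: "'w::ab_group_add"
  by (auto simp: sgnp_def)

lemma sgnp_add: "sgnp n (v + w) = sgnp n v + sgnp n w"
  and sgnp_diff: "sgnp n (v - w) = sgnp n v - sgnp n w"
  for v w :: "'w::ab_group_add"
  by (auto simp: sgnp_def)

lemma sgnlen_sgnlen [simp]: "sgnlen (sgnlen f) = f"
  by (simp add: sgnlen_def)

lemma contract_sgnlen: "contract x (sgnlen f) = (\<lambda>ys. - sgnlen (contract x f) ys)"
  by (simp add: contract_def sgnlen_def)

section \<open>Subspaces, and maps that are linear on a subspace\<close>

locale vsubspace = vector_space s for s :: "'a::field \<Rightarrow> 'w::ab_group_add \<Rightarrow> 'w" +
  fixes W :: "'w set"
  assumes subspace: "subspace W"
begin

lemma in_zero [simp]: "0 \<in> W" and in_add: "x \<in> W \<Longrightarrow> y \<in> W \<Longrightarrow> x + y \<in> W"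
  and in_scale: "x \<in> W \<Longrightarrow> s a x \<in> W" and in_neg: "x \<in> W \<Longrightarrow> - x \<in> W"
  and in_diff: "x \<in> W \<Longrightarrow> y \<in> W \<Longrightarrow> x - y \<in> W"
  using subspace subspace_0 subspace_add subspace_scale subspace_neg subspace_diff by auto

lemma in_sgnp: "x \<in> W \<Longrightarrow> sgnp n x \<in> W"
  by (simp add: sgnp_def in_neg)

lemma scale_sgnp: "s a (sgnp n x) = sgnp n (s a x)"
  by (simp add: sgnp_def)

lemmas closed = in_zero in_add in_scale in_neg in_diff in_sgnp

end

lemma lin_on_rules:
  assumes "lin_on s1 s2 A f" "vsubspace s1 A" "vector_space s2"
  shows "f 0 = 0" and "\<And>x y. x \<in> A \<Longrightarrow> y \<in> A \<Longrightarrow> f (x + y) = f x + f y"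
    and "\<And>a x. x \<in> A \<Longrightarrow> f (s1 a x) = s2 a (f x)"
    and "\<And>x. x \<in> A \<Longrightarrow> f (- x) = - f x"
    and "\<And>x y. x \<in> A \<Longrightarrow> y \<in> A \<Longrightarrow> f (x - y) = f x - f y"
    and "\<And>x n. x \<in> A \<Longrightarrow> f (sgnp n x) = sgnp n (f x)"
proof -
  interpret A: vsubspace s1 A by fact
  interpret s2: vector_space s2 by fact
  have l: "f (s1 a x + y) = s2 a (f x) + f y" if "x \<in> A" "y \<in> A" for a x y
    using assms(1) that by (auto simp: lin_on_def)
  show z: "f 0 = 0" using l[of 0 0 1] by simp
  show add: "f (x + y) = f x + f y" if "x \<in> A" "y \<in> A" for x y
    using l[OF that, of 1] by simp
  show sc: "f (s1 a x) = s2 a (f x)" if "x \<in> A" for a x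
    using l[OF that A.in_zero] z by simp
  show ng: "f (- x) = - f x" if "x \<in> A" for x
    using sc[OF that, of "- 1"] by simp
  show "f (x - y) = f x - f y" if "x \<in> A" "y \<in> A" for x y
    using add[of x "- y"] ng[of y] that A.in_neg by simp
  show "f (sgnp n x) = sgnp n (f x)" if "x \<in> A" for x n
    using ng[OF that] by (simp add: sgnp_def)
qed

section \<open>Multilinear and alternating functions on lists\<close>

definition mlin :: "('a::field \<Rightarrow> 'g::ab_group_add \<Rightarrow> 'g) \<Rightarrow> ('a \<Rightarrow> 'w::ab_group_add \<Rightarrow> 'w)
    \<Rightarrow> 'w set \<Rightarrow> ('g list \<Rightarrow> 'w) \<Rightarrow> bool" where
  "mlin sg sw W f \<longleftrightarrow> (\<forall>xs. f xs \<in> W) \<and>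
     (\<forall>us a y z vs. f (us @ (sg a y + z) # vs) = sw a (f (us @ y # vs)) + f (us @ z # vs))"

text \<open>Only adjacent repetitions are tested, because this is what an induction on the list can
  reach; \<open>altl_repeat\<close> recovers arbitrary positions.\<close>

definition altl :: "('a::field \<Rightarrow> 'g::ab_group_add \<Rightarrow> 'g) \<Rightarrow> ('a \<Rightarrow> 'w::ab_group_add \<Rightarrow> 'w)
    \<Rightarrow> 'w set \<Rightarrow> ('g list \<Rightarrow> 'w) \<Rightarrow> bool" where
  "altl sg sw W f \<longleftrightarrow> mlin sg sw W f \<and> (\<forall>us x vs. f (us @ x # x # vs) = 0)"

lemma mlinI:
  assumes "\<And>xs. f xs \<in> W"
    and "\<And>us a y z vs. f (us @ (sg a y + z) # vs) = sw a (f (us @ y # vs)) + f (us @ z # vs)"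
  shows "mlin sg sw W f"
  using assms by (simp add: mlin_def)

lemma altlI:
  assumes "mlin sg sw W f" and "\<And>us x vs. f (us @ x # x # vs) = 0"
  shows "altl sg sw W f"
  using assms by (simp add: altl_def)

lemma mlin_in: "mlin sg sw W f \<Longrightarrow> f xs \<in> W"
  by (simp add: mlin_def)

lemma mlin_lin: "mlin sg sw W f \<Longrightarrow> f (us @ (sg a y + z) # vs) = sw a (f (us @ y # vs)) + f (us @ z # vs)"
  by (simp add: mlin_def)

lemma mlin_lin_hd: "mlin sg sw W f \<Longrightarrow> f ((sg a y + z) # vs) = sw a (f (y # vs)) + f (z # vs)"
  using mlin_lin[where us = "[]"] by simp

lemma mlin_contract: "mlin sg sw W f \<Longrightarrow> mlin sg sw W (contract x f)"
  using mlin_lin[of sg sw W f "x # _"] by (simp add: mlin_def[of _ _ _ "contract x f"] contract_apply mlin_in)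

lemma altl_mlin: "altl sg sw W f \<Longrightarrow> mlin sg sw W f"
  by (simp add: altl_def)

lemma altl_adj: "altl sg sw W f \<Longrightarrow> f (us @ x # x # vs) = 0"
  by (simp add: altl_def)

lemma altl_contract: "altl sg sw W f \<Longrightarrow> altl sg sw W (contract x f)"
  using altl_adj[of sg sw W f "x # _"]
  by (simp add: altl_def[of _ _ _ "contract x f"] contract_apply mlin_contract altl_mlin)

context vsubspace
begin

context
  fixes sg :: "'a \<Rightarrow> 'g::ab_group_add \<Rightarrow> 'g"
  assumes vsg: "vector_space sg"
begin

interpretation sg: vector_space sg by (rule vsg)

lemma mlin_comb:
  "mlin sg s W f \<Longrightarrow> mlin sg s W g \<Longrightarrow> mlin sg s W (\<lambda>xs. s a (f xs) + g xs)"
  by (rule mlinI)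
    (simp_all add: closed mlin_in mlin_lin scale_right_distrib scale_left_commute[of a])

lemma altl_comb:
  "altl sg s W f \<Longrightarrow> altl sg s W g \<Longrightarrow> altl sg s W (\<lambda>xs. s a (f xs) + g xs)"
  by (simp add: altl_def mlin_comb)

lemma mlin_zero: "mlin sg s W (\<lambda>_. 0)"
  by (simp add: mlin_def closed)

lemma altl_zero: "altl sg s W (\<lambda>_. 0)"
  by (simp add: altl_def mlin_zero)

lemma altl_add: "altl sg s W f \<Longrightarrow> altl sg s W g \<Longrightarrow> altl sg s W (\<lambda>xs. f xs + g xs)"
  using altl_comb[of f g 1] by auto

lemma altl_diff: "altl sg s W f \<Longrightarrow> altl sg s W g \<Longrightarrow> altl sg s W (\<lambda>xs. f xs - g xs)"
  using altl_comb[of g f "-1"] by auto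

lemma mlin_sgnlen: "mlin sg s W f \<Longrightarrow> mlin sg s W (sgnlen f)"
  by (rule mlinI) (simp_all add: sgnlen_def closed mlin_in mlin_lin sgnp_add scale_sgnp)

lemma altl_sgnlen: "altl sg s W f \<Longrightarrow> altl sg s W (sgnlen f)"
  by (rule altlI) (simp_all add: mlin_sgnlen altl_mlin, simp add: altl_adj sgnlen_def)

lemma mlin_slot_add: "mlin sg s W f \<Longrightarrow> f (us @ (y + z) # vs) = f (us @ y # vs) + f (us @ z # vs)"
  using mlin_lin[where a = 1] by fastforce

lemma mlin_slot_zero: "mlin sg s W f \<Longrightarrow> f (us @ 0 # vs) = 0"
  using mlin_slot_add[of f us 0 0 vs] by simp

lemma mlin_slot_neg: "mlin sg s W f \<Longrightarrow> f (us @ (- y) # vs) = - f (us @ y # vs)"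
  using mlin_slot_add[of f us y "- y" vs] mlin_slot_zero[of f us vs]
  by (simp add: eq_neg_iff_add_eq_0 add.commute)

lemma altl_swap:
  assumes "altl sg s W f"
  shows "f (us @ x # y # vs) = - f (us @ y # x # vs)"
proof -
  note m = altl_mlin[OF assms]
  have "0 = f (us @ (x + y) # (x + y) # vs)"
    using altl_adj[OF assms] by simp
  also have "\<dots> = f (us @ x # (x + y) # vs) + f (us @ y # (x + y) # vs)"
    by (rule mlin_slot_add[OF m])
  also have "\<dots> = f (us @ x # y # vs) + f (us @ y # x # vs)"
    using mlin_slot_add[OF m, of "us @ [x]" x y vs] mlin_slot_add[OF m, of "us @ [y]" x y vs]
      altl_adj[OF assms] by simp
  finally show ?thesis by (simp add: eq_neg_iff_add_eq_0)
qed

lemma altl_swap_hd: "altl sg s W f \<Longrightarrow> f (x # y # vs) = - f (y # x # vs)"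
  using altl_swap[where us = "[]"] by simp

text \<open>Adjacent transpositions move the first \<open>x\<close> through \<open>ws\<close> until
  it meets the second one.\<close>

lemma altl_repeat:
  assumes "altl sg s W f"
  shows "f (us @ x # ws @ x # vs) = 0"
proof (induction ws arbitrary: us)
  case Nil
  then show ?case using altl_adj[OF assms] by simp
next
  case (Cons w ws)
  then show ?case using altl_swap[OF assms, of us x w "ws @ x # vs"] Cons[of "us @ [w]"] by simp
qed

end
end

text \<open>Cartan's formula i_x D + D i_x = \<Lambda>_x, read as a recursion that defines D from
  \<Lambda>. With the Lie derivative for \<Lambda> it gives the Chevalley-Eilenberg differential,
  with \<open>ptw \<theta>\<close> the action of an operator-valued 1-form, so multilinearity and
  alternation are proved once for both.\<close>

fun cartan :: "('g \<Rightarrow> ('g list \<Rightarrow> 'w) \<Rightarrow> 'g list \<Rightarrow> 'u::ab_group_add) \<Rightarrow> ('g list \<Rightarrow> 'w) \<Rightarrow> 'g list \<Rightarrow> 'u"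
  where
  "cartan \<Lambda> f [] = 0"
| "cartan \<Lambda> f (x # xs) = \<Lambda> x f xs - cartan \<Lambda> (contract x f) xs"

text \<open>\<open>op_diag\<close> says that \<Lambda>_x commutes with i_x. This makes D f vanish on
  lists starting with x, x: the two \<Lambda>-terms of the recursion cancel. For the Lie derivative
  it holds because [x, x] = 0.\<close>

locale cartan_op = W: vsubspace sw W + U: vsubspace su U + sg: vector_space sg
  for sg :: "'a::field \<Rightarrow> 'g::ab_group_add \<Rightarrow> 'g"
    and sw :: "'a \<Rightarrow> 'w::ab_group_add \<Rightarrow> 'w" and W
    and su :: "'a \<Rightarrow> 'u::ab_group_add \<Rightarrow> 'u" and U +
  fixes \<Lambda> :: "'g \<Rightarrow> ('g list \<Rightarrow> 'w) \<Rightarrow> 'g list \<Rightarrow> 'u"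
  assumes op_mlin: "mlin sg sw W f \<Longrightarrow> mlin sg su U (\<Lambda> x f)"
    and op_comb: "mlin sg sw W f \<Longrightarrow> mlin sg sw W g \<Longrightarrow>
      \<Lambda> x (\<lambda>ys. sw a (f ys) + g ys) xs = su a (\<Lambda> x f xs) + \<Lambda> x g xs"
    and op_vec: "mlin sg sw W f \<Longrightarrow> \<Lambda> (sg a x + y) f xs = su a (\<Lambda> x f xs) + \<Lambda> y f xs"
    and op_alt: "altl sg sw W f \<Longrightarrow> altl sg su U (\<Lambda> x f)"
    and op_diag: "mlin sg sw W f \<Longrightarrow> \<Lambda> x f (x # xs) = \<Lambda> x (contract x f) xs"
begin

lemma op_diff: "mlin sg sw W f \<Longrightarrow> mlin sg sw W g \<Longrightarrow> \<Lambda> x (\<lambda>ys. f ys - g ys) xs = \<Lambda> x f xs - \<Lambda> x g xs"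
  using op_comb[of g f x "-1"] by simp

lemma contract_comb: "contract x (\<lambda>ys. sw a (f ys) + g ys) = (\<lambda>ys. sw a (contract x f ys) + contract x g ys)"
  by (simp add: contract_def)

lemma cartan_comb:
  "mlin sg sw W f \<Longrightarrow> mlin sg sw W g \<Longrightarrow>
    cartan \<Lambda> (\<lambda>ys. sw a (f ys) + g ys) xs = su a (cartan \<Lambda> f xs) + cartan \<Lambda> g xs"
proof (induction xs arbitrary: f g)
  case (Cons x xs)
  then show ?case
    using Cons.IH[of "contract x f" "contract x g"]
    by (simp add: op_comb contract_comb mlin_contract U.scale_right_diff_distrib)
qed simp

lemma cartan_add: "mlin sg sw W f \<Longrightarrow> mlin sg sw W g \<Longrightarrow>
    cartan \<Lambda> (\<lambda>ys. f ys + g ys) xs = cartan \<Lambda> f xs + cartan \<Lambda> g xs"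
  using cartan_comb[of f g 1] by simp

lemma cartan_diff: "mlin sg sw W f \<Longrightarrow> mlin sg sw W g \<Longrightarrow>
    cartan \<Lambda> (\<lambda>ys. f ys - g ys) xs = cartan \<Lambda> f xs - cartan \<Lambda> g xs"
  using cartan_comb[of g f "-1"] by simp

lemma cartan_zero: "cartan \<Lambda> (\<lambda>_. 0) xs = 0"
  using cartan_add[of "\<lambda>_. 0" "\<lambda>_. 0" xs] W.mlin_zero[OF sg.vector_space_axioms] by simp

lemma cartan_neg: "mlin sg sw W f \<Longrightarrow> cartan \<Lambda> (\<lambda>ys. - f ys) xs = - cartan \<Lambda> f xs"
  using cartan_diff[of "\<lambda>_. 0" f xs] W.mlin_zero[OF sg.vector_space_axioms] cartan_zero by simp

lemma cartan_in: "mlin sg sw W f \<Longrightarrow> cartan \<Lambda> f xs \<in> U"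
  by (induction xs arbitrary: f) (auto intro!: U.closed mlin_in[OF op_mlin] mlin_contract)

lemma cartan_slot:
  "mlin sg sw W f \<Longrightarrow> cartan \<Lambda> f (us @ (sg a y + z) # vs) =
     su a (cartan \<Lambda> f (us @ y # vs)) + cartan \<Lambda> f (us @ z # vs)"
proof (induction us arbitrary: f)
  case Nil
  have "contract (sg a y + z) f = (\<lambda>ys. sw a (contract y f ys) + contract z f ys)"
    using mlin_lin_hd[OF Nil] by (simp add: contract_def)
  then show ?case
    using Nil by (simp add: op_vec cartan_comb mlin_contract U.scale_right_diff_distrib)
next
  case (Cons u us)
  show ?case
    using Cons.IH[OF mlin_contract[OF Cons.prems]] mlin_lin[OF op_mlin[OF Cons.prems]]
    by (simp add: U.scale_right_diff_distrib)
qed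

lemma cartan_mlin: "mlin sg sw W f \<Longrightarrow> mlin sg su U (cartan \<Lambda> f)"
  using cartan_in cartan_slot by (simp add: mlin_def)

lemma cartan_altl:
  assumes "altl sg sw W f"
  shows "altl sg su U (cartan \<Lambda> f)"
proof -
  have "cartan \<Lambda> f (us @ x # x # vs) = 0" for us x vs
    using assms
  proof (induction us arbitrary: f)
    case Nil
    have "contract x (contract x f) = (\<lambda>_. 0)"
      using altl_adj[OF Nil, of "[]"] by (simp add: contract_def)
    then show ?case
      using op_diag[OF altl_mlin[OF Nil]] by (simp add: cartan_zero)
  next
    case (Cons u us)
    show ?case
      using Cons.IH[OF altl_contract[OF Cons.prems]] altl_adj[OF op_alt[OF Cons.prems]] by simp
  qed
  then show ?thesis using cartan_mlin[OF altl_mlin[OF assms]] by (simp add: altl_def)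
qed

text \<open>D raises the form degree by one, so it anticommutes with the parity involution once each
  \<Lambda>_x commutes with it.\<close>

lemma cartan_sgnlen:
  assumes "\<And>x f. mlin sg sw W f \<Longrightarrow> \<Lambda> x (sgnlen f) = sgnlen (\<Lambda> x f)"
  shows "mlin sg sw W f \<Longrightarrow> cartan \<Lambda> (sgnlen f) xs = - sgnlen (cartan \<Lambda> f) xs"
proof (induction xs arbitrary: f)
  case (Cons x xs)
  have "mlin sg sw W (sgnlen (contract x f))"
    using Cons.prems by (intro W.mlin_sgnlen sg.vector_space_axioms mlin_contract)
  then have "cartan \<Lambda> (contract x (sgnlen f)) xs = sgnlen (cartan \<Lambda> (contract x f)) xs"
    using Cons.IH[of "contract x f"] Cons.prems by (simp add: contract_sgnlen cartan_neg mlin_contract)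
  then show ?case using assms[OF Cons.prems] by (simp add: sgnlen_def sgnp_diff)
qed (simp add: sgnlen_def)

end

text \<open>D raises the form degree by exactly one, so its value on \<open>xs\<close> sees
  \<open>f\<close> only on lists one shorter. This serves for homogeneity and for the induction on
  the form degree in \<open>omega_maps_agree\<close>.\<close>

lemma cartan_cong_length:
  assumes "\<And>x f g n ys. (\<And>ys. length ys = n \<Longrightarrow> f ys = g ys) \<Longrightarrow> length ys = n \<Longrightarrow> \<Lambda> x f ys = \<Lambda> x g ys"
  shows "(\<And>ys. Suc (length ys) = length xs \<Longrightarrow> f ys = g ys) \<Longrightarrow> cartan \<Lambda> f xs = cartan \<Lambda> g xs"
proof (induction xs arbitrary: f g)
  case (Cons x xs)
  have "cartan \<Lambda> (contract x f) xs = cartan \<Lambda> (contract x g) xs"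
    by (rule Cons.IH) (use Cons.prems in \<open>auto simp: contract_apply\<close>)
  moreover have "\<Lambda> x f xs = \<Lambda> x g xs"
    by (rule assms[of "length xs"]) (use Cons.prems in auto)
  ultimately show ?case by simp
qed simp

section \<open>The wedge product as a recursion\<close>

lemma permutation_insert_0_simps:
  "k < r \<Longrightarrow> permutation_insert r 0 \<tau> k = Suc (\<tau> k)"
  "permutation_insert r 0 \<tau> r = 0"
  "k \<ge> r \<Longrightarrow> permutation_insert r 0 \<tau> (Suc k) = Suc (\<tau> k)"
  by (simp_all add: permutation_insert_expand)

text \<open>Deleting the value 0 from the first block leaves a shuffle whose first block is shorter
  by one. In the wedge product this is the case where the head of the list goes into the scalar
  form.\<close>

lemma shuffles_fix_first:
  "{\<sigma> \<in> shuffles (Suc r) s. \<sigma> 0 = 0} = permutation_insert 0 0 ` shuffles r s"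
proof (intro equalityI subsetI)
  fix \<sigma> assume "\<sigma> \<in> {\<sigma> \<in> shuffles (Suc r) s. \<sigma> 0 = 0}"
  then have p: "\<sigma> permutes {0..<Suc (r + s)}" and z: "\<sigma> 0 = 0"
    and m1: "\<And>i j. i < j \<Longrightarrow> j < Suc r \<Longrightarrow> \<sigma> i < \<sigma> j"
    and m2: "\<And>i j. Suc r \<le> i \<Longrightarrow> i < j \<Longrightarrow> j < Suc r + s \<Longrightarrow> \<sigma> i < \<sigma> j"
    by (auto simp: shuffles_def)
  from p z permutation_fix[of 0 "r + s" 0]
  obtain \<tau> where t: "\<tau> permutes {0..<r + s}" and e: "\<sigma> = permutation_insert 0 0 \<tau>"
    by blast
  have e': "\<sigma> (Suc k) = Suc (\<tau> k)" for k
    unfolding e by (rule permutation_insert_0_simps) simp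
  have "\<tau> i < \<tau> j" if "i < j" "j < r" for i j
    using m1[of "Suc i" "Suc j"] that by (simp add: e')
  moreover have "\<tau> i < \<tau> j" if "r \<le> i" "i < j" "j < r + s" for i j
    using m2[of "Suc i" "Suc j"] that by (simp add: e')
  ultimately have "\<tau> \<in> shuffles r s" using t by (simp add: shuffles_def)
  with e show "\<sigma> \<in> permutation_insert 0 0 ` shuffles r s" by blast
next
  fix \<sigma> assume "\<sigma> \<in> permutation_insert 0 0 ` shuffles r s"
  then obtain \<tau> where e: "\<sigma> = permutation_insert 0 0 \<tau>" and t: "\<tau> permutes {0..<r + s}"
    and m1: "\<And>i j. i < j \<Longrightarrow> j < r \<Longrightarrow> \<tau> i < \<tau> j"
    and m2: "\<And>i j. r \<le> i \<Longrightarrow> i < j \<Longrightarrow> j < r + s \<Longrightarrow> \<tau> i < \<tau> j"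
    by (auto simp: shuffles_def)
  have e': "\<sigma> (Suc k) = Suc (\<tau> k)" for k
    unfolding e by (rule permutation_insert_0_simps) simp
  have z: "\<sigma> 0 = 0" by (simp add: e)
  have "\<sigma> i < \<sigma> j" if "i < j" "j < Suc r" for i j
    using that m1[of "i - 1" "j - 1"] by (cases i; cases j) (auto simp: e' z)
  moreover have "\<sigma> i < \<sigma> j" if "Suc r \<le> i" "i < j" "j < Suc r + s" for i j
    using that m2[of "i - 1" "j - 1"] by (cases i; cases j) (auto simp: e' z)
  moreover have "\<sigma> permutes {0..<Suc r + s}"
    using permutation_insert_permutes[OF t, of 0 0] e by simp
  ultimately show "\<sigma> \<in> {\<sigma> \<in> shuffles (Suc r) s. \<sigma> 0 = 0}"
    using z by (simp add: shuffles_def)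
qed

lemma shuffles_fix_second:
  "{\<sigma> \<in> shuffles r (Suc s). \<sigma> r = 0} = permutation_insert r 0 ` shuffles r s"
proof (intro equalityI subsetI)
  fix \<sigma> assume "\<sigma> \<in> {\<sigma> \<in> shuffles r (Suc s). \<sigma> r = 0}"
  then have p: "\<sigma> permutes {0..<Suc (r + s)}" and z: "\<sigma> r = 0"
    and m1: "\<And>i j. i < j \<Longrightarrow> j < r \<Longrightarrow> \<sigma> i < \<sigma> j"
    and m2: "\<And>i j. r \<le> i \<Longrightarrow> i < j \<Longrightarrow> j < r + Suc s \<Longrightarrow> \<sigma> i < \<sigma> j"
    by (auto simp: shuffles_def)
  from p z permutation_fix[of r "r + s" 0]
  obtain \<tau> where t: "\<tau> permutes {0..<r + s}" and e: "\<sigma> = permutation_insert r 0 \<tau>"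
    by auto
  note e' = permutation_insert_0_simps[where r = r and \<tau> = \<tau>, folded e]
  have "\<tau> i < \<tau> j" if "i < j" "j < r" for i j
    using m1[of i j] that by (simp add: e')
  moreover have "\<tau> i < \<tau> j" if "r \<le> i" "i < j" "j < r + s" for i j
    using m2[of "Suc i" "Suc j"] that by (simp add: e')
  ultimately have "\<tau> \<in> shuffles r s" using t by (simp add: shuffles_def)
  with e show "\<sigma> \<in> permutation_insert r 0 ` shuffles r s" by blast
next
  fix \<sigma> assume "\<sigma> \<in> permutation_insert r 0 ` shuffles r s"
  then obtain \<tau> where e: "\<sigma> = permutation_insert r 0 \<tau>" and t: "\<tau> permutes {0..<r + s}"
    and m1: "\<And>i j. i < j \<Longrightarrow> j < r \<Longrightarrow> \<tau> i < \<tau> j"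
    and m2: "\<And>i j. r \<le> i \<Longrightarrow> i < j \<Longrightarrow> j < r + s \<Longrightarrow> \<tau> i < \<tau> j"
    by (auto simp: shuffles_def)
  note e' = permutation_insert_0_simps[where r = r and \<tau> = \<tau>, folded e]
  have "\<sigma> i < \<sigma> j" if "i < j" "j < r" for i j
    using that m1[of i j] by (auto simp: e')
  moreover have "\<sigma> i < \<sigma> j" if "r \<le> i" "i < j" "j < r + Suc s" for i j
    using that m2[of "i - 1" "j - 1"] e'(2) by (cases j; cases "i = r"; cases i) (auto simp: e')
  moreover have "\<sigma> permutes {0..<r + Suc s}"
    using permutation_insert_permutes[OF t, of r 0] e by simp
  ultimately show "\<sigma> \<in> {\<sigma> \<in> shuffles r (Suc s). \<sigma> r = 0}"
    by (simp add: shuffles_def e')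
qed

text \<open>Both blocks are increasing, so the least value can only stand at the start of a block.
  The two cases become the two summands of the Leibniz rule.\<close>

lemma shuffle_zero_position:
  assumes "\<sigma> \<in> shuffles r s" "0 < r + s"
  shows "(0 < r \<and> \<sigma> 0 = 0) \<or> (0 < s \<and> \<sigma> r = 0)"
proof -
  have p: "\<sigma> permutes {0..<r + s}" using assms(1) by (simp add: shuffles_def)
  then obtain k where k: "k < r + s" "\<sigma> k = 0"
    using permutes_image[OF p] assms(2)
    by (metis (no_types, lifting) atLeastLessThan_iff imageE le0)
  show ?thesis
  proof (cases "k < r")
    case True
    then have "k = 0" using assms(1) k
      by (metis (no_types, lifting) bot_nat_0.not_eq_extremum mem_Collect_eq not_less0 shuffles_def)
    with True k show ?thesis by auto
  next
    case False
    have "k = r"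
    proof (rule ccontr)
      assume "k \<noteq> r"
      with False have "r < k" by simp
      then have "\<sigma> r < \<sigma> k" using assms(1) k unfolding shuffles_def by blast
      with k show False by simp
    qed
    with k show ?thesis by auto
  qed
qed

lemma finite_shuffles: "finite (shuffles r s)"
  by (rule finite_subset[OF _ finite_permutations[of "{0..<r + s}"]]) (auto simp: shuffles_def)

text \<open>The guards account for an empty block, which cannot contain the value 0.\<close>

lemma sum_shuffles_split:
  fixes t :: "(nat \<Rightarrow> nat) \<Rightarrow> 'w::ab_group_add"
  assumes "r \<le> Suc n"
  shows "(\<Sum>\<sigma>\<in>shuffles r (Suc n - r). t \<sigma>) =
     (if 0 < r then \<Sum>\<tau>\<in>shuffles (r - 1) (Suc n - r). t (permutation_insert 0 0 \<tau>) else 0)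
   + (if r < Suc n then \<Sum>\<tau>\<in>shuffles r (n - r). t (permutation_insert r 0 \<tau>) else 0)"
proof -
  let ?A = "{\<sigma> \<in> shuffles r (Suc n - r). 0 < r \<and> \<sigma> 0 = 0}"
  let ?B = "{\<sigma> \<in> shuffles r (Suc n - r). r < Suc n \<and> \<sigma> r = 0}"
  have inj: "inj_on (permutation_insert i 0) (shuffles r' s')" if "i < Suc n" "r' + s' = n" for i r' s'
    by (rule inj_on_subset[OF permutation_insert_inj_on[of i n 0]])
      (use that in \<open>auto simp: shuffles_def\<close>)
  have u: "shuffles r (Suc n - r) = ?A \<union> ?B"
    using shuffle_zero_position[of _ r "Suc n - r"] assms by fastforce
  have dj: "?A \<inter> ?B = {}"
  proof -
    have False if "\<sigma> \<in> shuffles r (Suc n - r)" "0 < r" "\<sigma> 0 = 0" "\<sigma> r = 0" for \<sigma>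
    proof -
      have "inj \<sigma>" using that(1) permutes_inj by (auto simp: shuffles_def)
      with that show False by (metis injD less_not_refl)
    qed
    then show ?thesis by blast
  qed
  have "sum t ?A = (if 0 < r then \<Sum>\<tau>\<in>shuffles (r - 1) (Suc n - r). t (permutation_insert 0 0 \<tau>) else 0)"
  proof (cases "0 < r")
    case True
    then have "?A = permutation_insert 0 0 ` shuffles (r - 1) (Suc n - r)"
      using shuffles_fix_first[of "r - 1" "Suc n - r"] by simp
    then show ?thesis using True assms by (simp add: sum.reindex inj)
  qed simp
  moreover have "sum t ?B = (if r < Suc n then \<Sum>\<tau>\<in>shuffles r (n - r). t (permutation_insert r 0 \<tau>) else 0)"
  proof (cases "r < Suc n")
    case True
    then have "?B = permutation_insert r 0 ` shuffles r (n - r)"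
      using shuffles_fix_second[of r "n - r"] by (simp add: Suc_diff_le)
    then show ?thesis using True by (simp add: sum.reindex inj)
  qed simp
  ultimately show ?thesis
    by (subst u, subst sum.union_disjoint) (use dj finite_shuffles in auto)
qed

text \<open>The head \<open>x\<close> is the first argument of one of the two factors. Inserting the
  value 0 at position 0 costs no sign; inserting it at position r costs (-1)^r, which is absorbed
  into \<open>sgnlen e\<close>.\<close>

lemma shuffle_sum_eq_lwedge:
  fixes sw :: "'a::field \<Rightarrow> 'w::ab_group_add \<Rightarrow> 'w"
  shows "(\<Sum>r\<in>{0..length xs}. \<Sum>\<sigma>\<in>shuffles r (length xs - r).
        sw (of_int (sign \<sigma>) * e (map (\<lambda>k. xs ! \<sigma> k) [0..<r]))
           (f (map (\<lambda>k. xs ! \<sigma> k) [r..<length xs]))) = lwedge sw e f xs"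
proof (induction xs arbitrary: e f)
  case Nil
  have "shuffles 0 0 = {id}" by (auto simp: shuffles_def)
  then show ?case by simp
next
  case (Cons x ys)
  define n where "n = length ys"
  define t where "t = (\<lambda>r \<sigma>. sw (of_int (sign \<sigma>) * e (map (\<lambda>k. (x # ys) ! \<sigma> k) [0..<r]))
           (f (map (\<lambda>k. (x # ys) ! \<sigma> k) [r..<Suc n])))"
  have perm: "\<tau> permutes {0..<n}" if "\<tau> \<in> shuffles r (n - r)" "r \<le> n" for r \<tau>
    using that by (simp add: shuffles_def)
  have A: "t (Suc r) (permutation_insert 0 0 \<tau>) =
      sw (of_int (sign \<tau>) * contract x e (map (\<lambda>k. ys ! \<tau> k) [0..<r]))
        (f (map (\<lambda>k. ys ! \<tau> k) [r..<n]))" if "\<tau> \<in> shuffles r (n - r)" "r \<le> n" for r \<tau>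
  proof -
    let ?\<sigma> = "permutation_insert 0 0 \<tau>"
    have 1: "map (\<lambda>k. (x # ys) ! ?\<sigma> k) [0..<Suc r] = x # map (\<lambda>k. ys ! \<tau> k) [0..<r]"
      by (simp add: upt_conv_Cons map_Suc_upt[symmetric] permutation_insert_0_simps del: upt_Suc)
    have 2: "map (\<lambda>k. (x # ys) ! ?\<sigma> k) [Suc r..<Suc n] = map (\<lambda>k. ys ! \<tau> k) [r..<n]"
      by (simp add: map_Suc_upt[symmetric] permutation_insert_0_simps del: upt_Suc)
    show ?thesis
      using signof_permutation_insert[OF perm[OF that], of 0 0, where 'a='a]
      by (simp add: t_def 1 2 contract_def del: upt_Suc)
  qed
  have B: "t r (permutation_insert r 0 \<tau>) =
      sw (of_int (sign \<tau>) * sgnlen e (map (\<lambda>k. ys ! \<tau> k) [0..<r]))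
        (contract x f (map (\<lambda>k. ys ! \<tau> k) [r..<n]))" if "\<tau> \<in> shuffles r (n - r)" "r \<le> n" for r \<tau>
  proof -
    let ?\<sigma> = "permutation_insert r 0 \<tau>"
    have 1: "map (\<lambda>k. (x # ys) ! ?\<sigma> k) [0..<r] = map (\<lambda>k. ys ! \<tau> k) [0..<r]"
      by (simp add: permutation_insert_0_simps)
    have 2: "map (\<lambda>k. (x # ys) ! ?\<sigma> k) [r..<Suc n] = x # map (\<lambda>k. ys ! \<tau> k) [r..<n]"
      using that(2)
      by (simp add: upt_conv_Cons map_Suc_upt[symmetric] permutation_insert_0_simps del: upt_Suc)
    show ?thesis
      using signof_permutation_insert[OF perm[OF that], of r 0, where 'a='a] that(2)
      by (simp add: t_def 1 2 contract_def sgnlen_def sgnp_def power_minus1_even minus_one_power_iff del: upt_Suc)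
  qed
  have "(\<Sum>r\<in>{0..Suc n}. \<Sum>\<sigma>\<in>shuffles r (Suc n - r). t r \<sigma>) =
      (\<Sum>r\<le>Suc n. if 0 < r then \<Sum>\<tau>\<in>shuffles (r - 1) (Suc n - r). t r (permutation_insert 0 0 \<tau>) else 0)
    + (\<Sum>r\<le>Suc n. if r < Suc n then \<Sum>\<tau>\<in>shuffles r (n - r). t r (permutation_insert r 0 \<tau>) else 0)"
    unfolding sum.distrib[symmetric] atLeast0AtMost
    by (intro sum.cong refl sum_shuffles_split) simp
  also have "(\<Sum>r\<le>Suc n. if 0 < r then \<Sum>\<tau>\<in>shuffles (r - 1) (Suc n - r). t r (permutation_insert 0 0 \<tau>) else 0)
     = (\<Sum>r\<le>n. \<Sum>\<tau>\<in>shuffles r (n - r). t (Suc r) (permutation_insert 0 0 \<tau>))"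
    by (subst sum.atMost_Suc_shift) simp
  also have "\<dots> = lwedge sw (contract x e) f ys"
    unfolding Cons.IH[symmetric] n_def[symmetric] atLeast0AtMost
    by (intro sum.cong refl A) auto
  also have "(\<Sum>r\<le>Suc n. if r < Suc n then \<Sum>\<tau>\<in>shuffles r (n - r). t r (permutation_insert r 0 \<tau>) else 0)
     = (\<Sum>r\<le>n. \<Sum>\<tau>\<in>shuffles r (n - r). t r (permutation_insert r 0 \<tau>))"
    by (simp add: less_Suc_eq_le)
  also have "\<dots> = lwedge sw (sgnlen e) (contract x f) ys"
    unfolding Cons.IH[symmetric] n_def[symmetric] atLeast0AtMost
    by (intro sum.cong refl B) auto
  finally show ?case by (simp add: t_def n_def)
qed

section \<open>The Chevalley--Eilenberg differential\<close>

lemma rem_nth_Cons: "rem_nth 0 (x # xs) = xs" "rem_nth (Suc i) (x # xs) = x # rem_nth i xs"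
  by (simp_all add: rem_nth_def)

text \<open>The adjoint action on the arguments, so that \<open>lieD\<close> is the Lie derivative.
  The bracket stays in the slot of the argument it replaces, which avoids the signs of the usual
  formula; they reappear in \<open>bract_eq_sum\<close>.\<close>

fun bract :: "('g \<Rightarrow> 'g \<Rightarrow> 'g) \<Rightarrow> 'g \<Rightarrow> ('g list \<Rightarrow> 'w::ab_group_add) \<Rightarrow> 'g list \<Rightarrow> 'w" where
  "bract br x f [] = 0"
| "bract br x f (y # ys) = f (br x y # ys) + bract br x (contract y f) ys"

definition lieD :: "('g \<Rightarrow> 'g \<Rightarrow> 'g) \<Rightarrow> ('g \<Rightarrow> 'w \<Rightarrow> 'w) \<Rightarrow> 'g \<Rightarrow> ('g list \<Rightarrow> 'w::ab_group_add) \<Rightarrow> 'g list \<Rightarrow> 'w"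
  where "lieD br act x f xs = act x (f xs) - bract br x f xs"

abbreviation ce :: "('g \<Rightarrow> 'g \<Rightarrow> 'g) \<Rightarrow> ('g \<Rightarrow> 'w \<Rightarrow> 'w) \<Rightarrow> ('g list \<Rightarrow> 'w::ab_group_add) \<Rightarrow> 'g list \<Rightarrow> 'w"
  where "ce br act \<equiv> cartan (lieD br act)"

section \<open>Lie algebras and their modules\<close>

locale lie_alg =
  fixes sg :: "'a::field \<Rightarrow> 'g::ab_group_add \<Rightarrow> 'g" and br :: "'g \<Rightarrow> 'g \<Rightarrow> 'g"
  assumes lie: "lie_algebra sg br"
begin

sublocale sg: vsubspace sg UNIV
proof -
  interpret vector_space sg using lie by (simp add: lie_algebra_def)
  show "vsubspace sg UNIV" by unfold_locales simp
qed

lemmas vsg = sg.vector_space_axioms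

lemma br_lin1: "br (sg a x + y) z = sg a (br x z) + br y z"
  and br_lin2: "br z (sg a x + y) = sg a (br z x) + br z y"
  and br_self [simp]: "br x x = 0"
  and br_cyc: "br x (br y z) + br y (br z x) + br z (br x y) = 0"
  using lie by (auto simp: lie_algebra_def lin_on_def)

lemma br_swap: "br x y = - br y x"
proof -
  have add1: "br (x + y) z = br x z + br y z" and add2: "br z (x + y) = br z x + br z y" for x y z
    using br_lin1[of 1 x y z] br_lin2[of z 1 x y] by auto
  have "0 = br (x + y) (x + y)" by (simp only: br_self)
  also have "\<dots> = br x y + br y x" by (simp only: add1 add2) simp
  finally show ?thesis by (metis eq_neg_iff_add_eq_0)
qed

lemma br_zero2: "br x 0 = 0"
  using br_lin2[of x 1 0 0] by simp

lemma br_neg2: "br x (- y) = - br x y"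
  using br_lin2[of x "-1" y 0] br_zero2 by simp

lemma jacobi: "br (br x y) z = br x (br y z) - br y (br x z)"
proof -
  have "br y (br z x) = - br y (br x z)" using br_swap[of z x] br_neg2 by metis
  then have "br x (br y z) - br y (br x z) + br z (br x y) = 0" using br_cyc[of x y z] by simp
  then show ?thesis unfolding br_swap[of "br x y" z] by (metis minus_unique add.commute)
qed

end

locale lie_mod = lie_alg sg br
  for sg :: "'a::field \<Rightarrow> 'g::ab_group_add \<Rightarrow> 'g" and br :: "'g \<Rightarrow> 'g \<Rightarrow> 'g" +
  fixes sw :: "'a \<Rightarrow> 'w::ab_group_add \<Rightarrow> 'w" and act :: "'g \<Rightarrow> 'w \<Rightarrow> 'w" and W :: "'w set"
  assumes mod: "lie_module_on sg br sw act W"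
begin

sublocale W: vsubspace sw W
  using mod by (auto simp: lie_module_on_def vsubspace_def vsubspace_axioms_def)

lemma act_in: "w \<in> W \<Longrightarrow> act x w \<in> W"
  and act_lin_vec: "w \<in> W \<Longrightarrow> lin_on sg sw UNIV (\<lambda>x. act x w)"
  and act_lin: "lin_on sw sw W (act x)"
  and act_br: "w \<in> W \<Longrightarrow> act (br x y) w = act x (act y w) - act y (act x w)"
  using mod by (auto simp: lie_module_on_def)

lemmas act_rules = lin_on_rules[OF act_lin W.vsubspace_axioms W.vector_space_axioms]

lemma bract_comb: "bract br x (\<lambda>ys. sw a (f ys) + g ys) xs = sw a (bract br x f xs) + bract br x g xs"
proof (induction xs arbitrary: f g)
  case (Cons y ys)
  show ?case using Cons[of "contract y f" "contract y g"]
    by (simp add: contract_def W.scale_right_distrib algebra_simps)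
qed simp

lemma bract_in: "(\<And>ys. f ys \<in> W) \<Longrightarrow> bract br x f xs \<in> W"
  by (induction xs arbitrary: f) (auto intro!: W.closed simp: contract_apply)

lemma bract_vec: "mlin sg sw W f \<Longrightarrow> bract br (sg a x + y) f xs = sw a (bract br x f xs) + bract br y f xs"
proof (induction xs arbitrary: f)
  case (Cons z zs)
  show ?case
    unfolding bract.simps br_lin1 Cons.IH[OF mlin_contract[OF Cons.prems]]
      mlin_lin_hd[OF Cons.prems] W.scale_right_distrib
    by (simp add: add_ac)
qed simp

lemma bract_slot: "mlin sg sw W f \<Longrightarrow> bract br x f (us @ (sg a y + z) # vs) =
    sw a (bract br x f (us @ y # vs)) + bract br x f (us @ z # vs)"
proof (induction us arbitrary: f)
  case Nil
  have "contract (sg a y + z) f = (\<lambda>ys. sw a (contract y f ys) + contract z f ys)"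
    using mlin_lin_hd[OF Nil] by (simp add: contract_def)
  then show ?case
    using mlin_lin_hd[OF Nil] by (simp add: br_lin2 bract_comb W.scale_right_distrib)
next
  case (Cons u us)
  show ?case
    using Cons.IH[OF mlin_contract[OF Cons.prems]] mlin_lin[OF Cons.prems, of "br x u # us" a y z vs]
    by (simp add: W.scale_right_distrib algebra_simps)
qed

lemma bract_zero: "bract br x (\<lambda>_. 0) xs = (0::'w)"
  using bract_comb[of x 1 "\<lambda>_. 0" "\<lambda>_. 0" xs] by simp

text \<open>The two terms where the bracket hits one of the equal neighbours cancel by antisymmetry;
  all others still contain the repetition.\<close>

lemma bract_adj: "altl sg sw W f \<Longrightarrow> bract br x f (us @ y # y # vs) = 0"
proof (induction us arbitrary: f)
  case Nil
  have "contract y (contract y f) = (\<lambda>_. 0)"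
    using altl_adj[OF Nil, of "[]"] by (simp add: contract_def)
  then show ?case using W.altl_swap_hd[OF vsg Nil, of y "br x y" vs]
    by (simp add: bract_zero contract_apply)
next
  case (Cons u us)
  show ?case
    using Cons.IH[OF altl_contract[OF Cons.prems]] altl_adj[OF Cons.prems, of "br x u # us"] by simp
qed

section \<open>Cartan calculus: Lie derivative and differential\<close>

lemma lieD_mlin: "mlin sg sw W f \<Longrightarrow> mlin sg sw W (lieD br act x f)"
  by (auto simp: mlin_def[of _ _ _ "lieD br act x f"] lieD_def mlin_lin bract_slot act_rules W.scale_right_diff_distrib
      act_in mlin_in W.closed intro!: W.closed bract_in)

lemma lieD_comb: "mlin sg sw W f \<Longrightarrow> mlin sg sw W g \<Longrightarrow>
    lieD br act x (\<lambda>ys. sw a (f ys) + g ys) xs = sw a (lieD br act x f xs) + lieD br act x g xs"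
  by (simp add: lieD_def bract_comb act_rules W.scale_right_diff_distrib mlin_in W.closed)

lemma lieD_cartan: "cartan_op sg sw W sw W (lieD br act)"
proof unfold_locales
  fix f x y a xs
  assume f: "mlin sg sw W f"
  have "act (sg a x + y) (f xs) = sw a (act x (f xs)) + act y (f xs)"
    using act_lin_vec[OF mlin_in[OF f]] by (simp add: lin_on_def)
  then show "lieD br act (sg a x + y) f xs = sw a (lieD br act x f xs) + lieD br act y f xs"
    by (simp add: lieD_def bract_vec[OF f] W.scale_right_diff_distrib)
next
  fix f x assume f: "altl sg sw W f"
  then show "altl sg sw W (lieD br act x f)"
    using lieD_mlin[OF altl_mlin[OF f]] altl_adj[OF f]
    by (auto simp: altl_def lieD_def bract_adj act_rules)
next
  fix f x xs assume f: "mlin sg sw W f"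
  then show "lieD br act x f (x # xs) = lieD br act x (contract x f) xs"
    using W.mlin_slot_zero[OF vsg f, of "[]"] by (simp add: lieD_def contract_apply)
qed (auto simp: lieD_mlin lieD_comb)

sublocale ce: cartan_op sg sw W sw W "lieD br act"
  by (rule lieD_cartan)

lemma bract_sgnlen: "bract br x (sgnlen f) xs = sgnlen (bract br x f) xs" for f :: "'g list \<Rightarrow> 'w"
proof (induction xs arbitrary: f)
  case (Cons y ys)
  have "bract br x (\<lambda>zs. - sgnlen (contract y f) zs) ys = - bract br x (sgnlen (contract y f)) ys"
    using bract_comb[of x "-1" "sgnlen (contract y f)" "\<lambda>_. 0" ys] by (simp add: bract_zero)
  then show ?case
    by (simp add: contract_sgnlen Cons) (simp add: sgnlen_def sgnp_add)
qed (simp add: sgnlen_def)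

lemma lieD_sgnlen: "mlin sg sw W f \<Longrightarrow> lieD br act x (sgnlen f) = sgnlen (lieD br act x f)"
  by (rule ext) (simp add: lieD_def bract_sgnlen, simp add: sgnlen_def lieD_def sgnp_diff act_rules mlin_in)

lemma ce_sgnlen: "mlin sg sw W f \<Longrightarrow> ce br act (sgnlen f) xs = - sgnlen (ce br act f) xs"
  by (rule ce.cartan_sgnlen[OF lieD_sgnlen])

lemma lieD_Cons: "lieD br act x f (z # zs) = lieD br act x (contract z f) zs - f (br x z # zs)"
  by (simp add: lieD_def contract_apply)

lemma contract_lieD: "contract z (lieD br act x f) = (\<lambda>zs. lieD br act x (contract z f) zs - contract (br x z) f zs)"
  unfolding contract_def[of z "lieD br act x f"] lieD_Cons by (simp add: contract_apply)

lemma contract_ce: "contract y (ce br act f) = (\<lambda>ys. lieD br act y f ys - ce br act (contract y f) ys)"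
  by (simp add: contract_def[of y "ce br act f"])

lemma lieD_lieD_Cons:
  assumes "mlin sg sw W f"
  shows "lieD br act x (lieD br act y f) (z # zs) = lieD br act x (lieD br act y (contract z f)) zs
    - lieD br act x (contract (br y z) f) zs - lieD br act y (contract (br x z) f) zs + f (br y (br x z) # zs)"
proof -
  have "lieD br act x (contract z (lieD br act y f)) zs =
      lieD br act x (lieD br act y (contract z f)) zs - lieD br act x (contract (br y z) f) zs"
    unfolding contract_lieD
    by (rule ce.op_diff) (intro lieD_mlin mlin_contract assms)+
  then show ?thesis by (simp add: lieD_Cons[of x "lieD br act y f"] lieD_Cons[of y f])
qed

text \<open>At the empty list this is the module axiom; every further argument contributes an
  instance of the Jacobi identity.\<close>

lemma lieD_commutator:
  "mlin sg sw W f \<Longrightarrow>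
    lieD br act x (lieD br act y f) xs - lieD br act y (lieD br act x f) xs = lieD br act (br x y) f xs"
proof (induction xs arbitrary: f)
  case Nil
  then show ?case by (simp add: lieD_def act_br mlin_in)
next
  case (Cons z zs)
  have "f (br (br x y) z # zs) = f (br x (br y z) # zs) - f (br y (br x z) # zs)"
    unfolding jacobi using W.mlin_slot_add[OF vsg Cons.prems, of "[]"] W.mlin_slot_neg[OF vsg Cons.prems, of "[]"]
    by (metis (no_types) append_Nil diff_conv_add_uminus)
  then show ?case
    using Cons.IH[OF mlin_contract[OF Cons.prems], of z]
    by (simp add: lieD_lieD_Cons[OF Cons.prems] lieD_Cons[of "br x y"] algebra_simps)
qed

text \<open>Contraction with y turns the claim for f into the claim for i_y f, up to the term
  [L_x, L_y] - L_[x,y], which vanishes by \<open>lieD_commutator\<close>.\<close>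

lemma lieD_ce: "mlin sg sw W f \<Longrightarrow> lieD br act x (ce br act f) xs = ce br act (lieD br act x f) xs"
proof (induction xs arbitrary: f)
  case Nil
  then show ?case by (simp add: lieD_def act_rules)
next
  case (Cons y ys)
  note m = Cons.prems lieD_mlin ce.cartan_mlin mlin_contract
  have "lieD br act x (ce br act f) (y # ys) =
      lieD br act x (lieD br act y f) ys - lieD br act x (ce br act (contract y f)) ys
      - lieD br act (br x y) f ys + ce br act (contract (br x y) f) ys"
    by (simp add: lieD_Cons contract_ce ce.op_diff m)
  moreover have "ce br act (lieD br act x f) (y # ys) = lieD br act y (lieD br act x f) ys
      - ce br act (lieD br act x (contract y f)) ys + ce br act (contract (br x y) f) ys"
    by (simp add: contract_lieD ce.cartan_diff m)
  ultimately show ?case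
    using Cons.IH[OF mlin_contract[OF Cons.prems], of y] lieD_commutator[OF Cons.prems, of x y ys]
    by (simp add: algebra_simps)
qed

text \<open>Using i_x d = L_x - d i_x twice gives i_x d d = L_x d - d L_x + d d i_x. The first two
  terms cancel, and the last vanishes by induction.\<close>

lemma ce_ce: "mlin sg sw W f \<Longrightarrow> ce br act (ce br act f) xs = 0"
proof (induction xs arbitrary: f)
  case (Cons x xs)
  have "ce br act (contract x (ce br act f)) xs = ce br act (lieD br act x f) xs - ce br act (ce br act (contract x f)) xs"
    unfolding contract_ce by (intro ce.cartan_diff lieD_mlin ce.cartan_mlin mlin_contract Cons.prems)
  then show ?case using Cons.IH[OF mlin_contract[OF Cons.prems], of x]
    unfolding cartan.simps(2)[of _ _ x] lieD_ce[OF Cons.prems] by simp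
qed simp

text \<open>Moving the bracket from slot j to the front passes j arguments of an alternating
  function, whence the sign (-1)^j.\<close>

lemma bract_eq_sum:
  "altl sg sw W f \<Longrightarrow> bract br x f xs = (\<Sum>j<length xs. sgnp j (f (br x (xs ! j) # rem_nth j xs)))"
proof (induction xs arbitrary: f)
  case (Cons y ys)
  have e: "sgnp (Suc j) (f (br x ((y # ys) ! Suc j) # rem_nth (Suc j) (y # ys))) =
      sgnp j (contract y f (br x (ys ! j) # rem_nth j ys))" for j
    unfolding rem_nth_Cons nth_Cons_Suc contract_apply
      W.altl_swap_hd[OF vsg Cons.prems, of "br x (ys ! j)" y]
    by simp
  show ?case
    unfolding bract.simps Cons.IH[OF altl_contract[OF Cons.prems]] length_Cons sum.lessThan_Suc_shift e
    by (simp add: rem_nth_Cons)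
qed simp

text \<open>Ties the recursion to the explicit formula in \<open>dCE\<close>. The terms with i = 0
  add up to the Lie derivative along the head \<open>x\<close>. In the others the indices shift by
  one: this gives the minus sign directly in the first sum, and in the second through moving
  \<open>x\<close> in front of the bracket.\<close>

lemma ce_eq_sum:
  "altl sg sw W f \<Longrightarrow> ce br act f xs =
    (\<Sum>i<length xs. sgnp i (act (xs ! i) (f (rem_nth i xs))))
    + (\<Sum>j<length xs. \<Sum>i<j. sgnp (i + j) (f (br (xs ! i) (xs ! j) # rem_nth i (rem_nth j xs))))"
proof (induction xs arbitrary: f)
  case (Cons x xs)
  let ?n = "length xs"
  have a: "sgnp (Suc i) (act ((x # xs) ! Suc i) (f (rem_nth (Suc i) (x # xs)))) =
      - sgnp i (act (xs ! i) (contract x f (rem_nth i xs)))" for i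
    by (simp add: rem_nth_Cons contract_apply)
  have b: "sgnp (Suc i + Suc j) (f (br ((x # xs) ! Suc i) ((x # xs) ! Suc j) # rem_nth (Suc i) (rem_nth (Suc j) (x # xs))))
      = - sgnp (i + j) (contract x f (br (xs ! i) (xs ! j) # rem_nth i (rem_nth j xs)))" for i j
    unfolding rem_nth_Cons nth_Cons_Suc contract_apply
      W.altl_swap_hd[OF vsg Cons.prems, of "br (xs ! i) (xs ! j)" x]
    by simp
  have c: "sgnp (0 + Suc j) (f (br ((x # xs) ! 0) ((x # xs) ! Suc j) # rem_nth 0 (rem_nth (Suc j) (x # xs))))
      = - sgnp j (f (br x (xs ! j) # rem_nth j xs))" for j
    by (simp add: rem_nth_Cons)
  have s1: "(\<Sum>i<length (x # xs). sgnp i (act ((x # xs) ! i) (f (rem_nth i (x # xs)))))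
      = act x (f xs) - (\<Sum>i<?n. sgnp i (act (xs ! i) (contract x f (rem_nth i xs))))"
    unfolding length_Cons sum.lessThan_Suc_shift a sum_negf by (simp add: rem_nth_Cons)
  have s2: "(\<Sum>j<length (x # xs). \<Sum>i<j. sgnp (i + j)
        (f (br ((x # xs) ! i) ((x # xs) ! j) # rem_nth i (rem_nth j (x # xs))))) =
      - bract br x f xs
      - (\<Sum>j<?n. \<Sum>i<j. sgnp (i + j) (contract x f (br (xs ! i) (xs ! j) # rem_nth i (rem_nth j xs))))"
    unfolding length_Cons sum.lessThan_Suc_shift b c bract_eq_sum[OF Cons.prems] sum_negf sum.distrib
    by simp
  show ?case
    unfolding s1 s2 cartan.simps Cons.IH[OF altl_contract[OF Cons.prems]] lieD_def[of br act x f] by simp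
qed simp

end

section \<open>Operator-valued one-forms\<close>

definition ptw :: "('g \<Rightarrow> 'w \<Rightarrow> 'u) \<Rightarrow> 'g \<Rightarrow> ('g list \<Rightarrow> 'w) \<Rightarrow> 'g list \<Rightarrow> 'u" where
  "ptw \<theta> x f ys = \<theta> x (f ys)"

lemma cartan_ptw_Cons: "cartan (ptw \<theta>) f (x # xs) = \<theta> x (f xs) - cartan (ptw \<theta>) (contract x f) xs"
  by (simp add: ptw_def)

lemma contract_in: "(\<And>ys. f ys \<in> W) \<Longrightarrow> contract x f ys \<in> W"
  by (simp add: contract_apply)

context vsubspace
begin

lemma mlin_compose:
  assumes "vsubspace su U" "lin_on s su W phi" "\<And>w. w \<in> W \<Longrightarrow> phi w \<in> U"
    and f: "mlin sg s W f"
  shows "mlin sg su U (\<lambda>xs. phi (f xs))"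
proof (rule mlinI)
  interpret U: vsubspace su U by fact
  note r = lin_on_rules[OF assms(2) vsubspace_axioms U.vector_space_axioms]
  show "phi (f (us @ (sg a y + z) # vs)) = su a (phi (f (us @ y # vs))) + phi (f (us @ z # vs))" for us a y z vs
    by (simp add: mlin_lin[OF f] r mlin_in[OF f] closed)
qed (rule assms(3)[OF mlin_in[OF f]])

lemma altl_compose:
  assumes "vsubspace su U" "lin_on s su W phi" "\<And>w. w \<in> W \<Longrightarrow> phi w \<in> U"
    and f: "altl sg s W f"
  shows "altl sg su U (\<lambda>xs. phi (f xs))"
proof (rule altlI)
  interpret U: vsubspace su U by fact
  note r = lin_on_rules[OF assms(2) vsubspace_axioms U.vector_space_axioms]
  show "phi (f (us @ x # x # vs)) = 0" for us x vs
    by (simp add: altl_adj[OF f] r)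
qed (rule mlin_compose[OF assms(1-3) altl_mlin[OF f]])

end

text \<open>An operator-valued 1-form \<open>\<theta>\<close> acts on cochains by
  \<open>(x\<^sub>0,\<dots>,x\<^sub>p) \<mapsto> \<Sum> (-1)\<^sup>i \<theta>(x\<^sub>i) f(\<dots>,x\<^sub>i omitted,\<dots>)\<close>; this is \<open>cartan (ptw \<theta>)\<close>.\<close>

locale op_form = W: vsubspace sw W + U: vsubspace su U + sg: vector_space sg
  for sg :: "'a::field \<Rightarrow> 'g::ab_group_add \<Rightarrow> 'g"
    and sw :: "'a \<Rightarrow> 'w::ab_group_add \<Rightarrow> 'w" and W
    and su :: "'a \<Rightarrow> 'u::ab_group_add \<Rightarrow> 'u" and U +
  fixes \<theta> :: "'g \<Rightarrow> 'w \<Rightarrow> 'u"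
  assumes form_in: "w \<in> W \<Longrightarrow> \<theta> x w \<in> U"
    and form_lin: "lin_on sw su W (\<theta> x)"
    and form_vec: "w \<in> W \<Longrightarrow> lin_on sg su UNIV (\<lambda>x. \<theta> x w)"
begin

lemmas form_rules = lin_on_rules[OF form_lin W.vsubspace_axioms U.vector_space_axioms]

sublocale cartan_op sg sw W su U "ptw \<theta>"
proof unfold_locales
  fix f x assume "mlin sg sw W f"
  then show "mlin sg su U (ptw \<theta> x f)"
    using W.mlin_compose[OF U.vsubspace_axioms form_lin form_in] by (simp add: ptw_def[abs_def])
next
  fix f x assume "altl sg sw W f"
  then show "altl sg su U (ptw \<theta> x f)"
    using W.altl_compose[OF U.vsubspace_axioms form_lin form_in] by (simp add: ptw_def[abs_def])
next
  fix f g x a xs assume "mlin sg sw W f" "mlin sg sw W g"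
  then show "ptw \<theta> x (\<lambda>ys. sw a (f ys) + g ys) xs = su a (ptw \<theta> x f xs) + ptw \<theta> x g xs"
    by (simp add: ptw_def form_rules mlin_in W.closed)
next
  fix f x y a xs assume f: "mlin sg sw W f"
  show "ptw \<theta> (sg a x + y) f xs = su a (ptw \<theta> x f xs) + ptw \<theta> y f xs"
    using form_vec[OF mlin_in[OF f]] by (simp add: ptw_def lin_on_def)
qed (simp add: ptw_def contract_apply)

text \<open>Stated for arbitrary functions with values in \<open>W\<close>, because it is applied to
  wedge products with an arbitrary scalar function \<open>e\<close>, which are not known to be
  multilinear.\<close>

lemma cartan_ptw_add:
  "(\<And>ys. f ys \<in> W) \<Longrightarrow> (\<And>ys. g ys \<in> W) \<Longrightarrow>
    cartan (ptw \<theta>) (\<lambda>ys. f ys + g ys) xs = cartan (ptw \<theta>) f xs + cartan (ptw \<theta>) g xs"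
proof (induction xs arbitrary: f g)
  case (Cons x xs)
  have "contract x (\<lambda>ys. f ys + g ys) = (\<lambda>ys. contract x f ys + contract x g ys)"
    by (simp add: contract_def)
  then show ?case
    using Cons.IH[of "contract x f" "contract x g"] Cons.prems
    by (simp add: cartan_ptw_Cons form_rules contract_in del: cartan.simps)
qed simp

end

section \<open>Compatibility with the wedge product\<close>

context vsubspace
begin

lemma lwedge_in: "(\<And>ys. f ys \<in> W) \<Longrightarrow> lwedge s e f xs \<in> W"
  by (induction xs arbitrary: e f) (auto intro!: closed simp: contract_apply)

lemma lwedge_neg_left: "lwedge s (\<lambda>ys. - e ys) f xs = - lwedge s e f xs"
proof (induction xs arbitrary: e f)
  case (Cons x xs)
  have "contract x (\<lambda>ys. - e ys) = (\<lambda>ys. - contract x e ys)" "sgnlen (\<lambda>ys. - e ys) = (\<lambda>ys. - sgnlen e ys)"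
    by (simp_all add: contract_def sgnlen_def)
  then show ?case using Cons by simp
qed simp

lemma lwedge_zero_left: "lwedge s (\<lambda>_. 0) f xs = 0"
  by (induction xs arbitrary: f) (simp_all add: contract_def sgnlen_def)

lemma lwedge_diff_right: "lwedge s e (\<lambda>ys. f ys - g ys) xs = lwedge s e f xs - lwedge s e g xs"
proof (induction xs arbitrary: e f g)
  case (Cons x xs)
  have "contract x (\<lambda>ys. f ys - g ys) = (\<lambda>ys. contract x f ys - contract x g ys)"
    by (simp add: contract_def)
  then show ?case using Cons by simp
qed (simp add: scale_right_diff_distrib)

lemma lwedge_zero_right: "lwedge s e (\<lambda>_. 0) xs = 0"
  using lwedge_diff_right[of e "\<lambda>_. 0" "\<lambda>_. 0" xs] by simp

lemma lwedge_neg_right: "lwedge s e (\<lambda>ys. - f ys) xs = - lwedge s e f xs"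
  using lwedge_diff_right[of e "\<lambda>_. 0" f xs] lwedge_zero_right by simp

lemma lwedge_compose:
  assumes "vector_space su" "lin_on s su W phi"
  shows "(\<And>ys. f ys \<in> W) \<Longrightarrow> lwedge su e (\<lambda>ys. phi (f ys)) xs = phi (lwedge s e f xs)"
proof (induction xs arbitrary: e f)
  case Nil
  then show ?case by (simp add: lin_on_rules[OF assms(2) vsubspace_axioms assms(1)])
next
  case (Cons x xs)
  have "contract x (\<lambda>ys. phi (f ys)) = (\<lambda>ys. phi (contract x f ys))"
    by (simp add: contract_def)
  then show ?case
    using Cons by (simp add: contract_in lwedge_in lin_on_rules[OF assms(2) vsubspace_axioms assms(1)])
qed

lemma sgnlen_lwedge: "sgnlen (lwedge s e f) xs = lwedge s (sgnlen e) (sgnlen f) xs"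
proof (induction xs arbitrary: e f)
  case (Cons x xs)
  have "sgnlen (lwedge s e f) (x # xs) =
      - sgnlen (lwedge s (contract x e) f) xs - sgnlen (lwedge s (sgnlen e) (contract x f)) xs"
    by (simp add: sgnlen_def[of "lwedge s _ _"] sgnp_add)
  then show ?case
    by (simp add: Cons contract_sgnlen lwedge_neg_left lwedge_neg_right)
qed (simp add: sgnlen_def)

end

text \<open>An operator-valued 1-form is an odd operator, so it passes \<open>e\<close> with the
  Koszul sign (-1)^|e|. This is the source of the \<Omega>-linearity of \<open>proj\<close>.\<close>

lemma (in op_form) cartan_ptw_lwedge:
  "(\<And>ys. f ys \<in> W) \<Longrightarrow>
    cartan (ptw \<theta>) (lwedge sw e f) xs = lwedge su (sgnlen e) (cartan (ptw \<theta>) f) xs"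
proof (induction xs arbitrary: e f)
  case (Cons x xs)
  have 1: "contract x (lwedge sw e f) =
      (\<lambda>ys. lwedge sw (contract x e) f ys + lwedge sw (sgnlen e) (contract x f) ys)"
    by (simp add: contract_def[of x "lwedge sw e f"])
  have 2: "contract x (cartan (ptw \<theta>) f) = (\<lambda>ys. \<theta> x (f ys) - cartan (ptw \<theta>) (contract x f) ys)"
    by (simp add: contract_def[of x "cartan (ptw \<theta>) f"] cartan_ptw_Cons del: cartan.simps)
  show ?case
    using Cons.prems
    by (simp add: 1 2 cartan_ptw_add W.lwedge_in Cons.IH contract_sgnlen cartan_ptw_Cons contract_in
        U.lwedge_neg_left U.lwedge_diff_right W.lwedge_compose[OF U.vector_space_axioms form_lin]
        del: cartan.simps)
qed simp

section \<open>Linear maps between modules that may fail to be equivariant\<close>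

locale lie_mod_pair = W: lie_mod sg br sw act W + U: lie_mod sg br su actu U
  for sg :: "'a::field \<Rightarrow> 'g::ab_group_add \<Rightarrow> 'g" and br :: "'g \<Rightarrow> 'g \<Rightarrow> 'g"
    and sw :: "'a \<Rightarrow> 'w::ab_group_add \<Rightarrow> 'w" and act :: "'g \<Rightarrow> 'w \<Rightarrow> 'w" and W :: "'w set"
    and su :: "'a \<Rightarrow> 'u::ab_group_add \<Rightarrow> 'u" and actu :: "'g \<Rightarrow> 'u \<Rightarrow> 'u" and U :: "'u set" +
  fixes phi :: "'w \<Rightarrow> 'u"
  assumes phi_lin: "lin_on sw su W phi" and phi_in: "w \<in> W \<Longrightarrow> phi w \<in> U"
begin

text \<open>The commutator [x, phi], which vanishes on \<open>W\<close> exactly when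
  \<open>phi\<close> is equivariant there. Taken for the contraction, it is the 1-form that perturbs
  the projection.\<close>

definition defect :: "'g \<Rightarrow> 'w \<Rightarrow> 'u" where
  "defect x w = actu x (phi w) - phi (act x w)"

lemmas phi_rules = lin_on_rules[OF phi_lin W.W.vsubspace_axioms U.W.vector_space_axioms]

sublocale op_form sg sw W su U defect
proof unfold_locales
  fix w x assume "w \<in> W"
  then show "defect x w \<in> U"
    by (simp add: defect_def phi_in W.act_in U.act_in U.W.closed)
next
  show "lin_on sw su W (defect x)" for x
    by (simp add: lin_on_def defect_def phi_rules phi_in W.act_rules U.act_rules W.W.closed W.act_in U.W.closed
        U.W.scale_right_diff_distrib)
next
  fix w assume w: "w \<in> W"
  have "act (sg a x + y) w = sw a (act x w) + act y w"
    "actu (sg a x + y) (phi w) = su a (actu x (phi w)) + actu y (phi w)" for a x y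
    using W.act_lin_vec[OF w] U.act_lin_vec[OF phi_in[OF w]] by (auto simp: lin_on_def)
  then show "lin_on sg su UNIV (\<lambda>x. defect x w)"
    using w by (simp add: lin_on_def defect_def phi_rules W.act_in W.W.closed U.W.scale_right_diff_distrib)
qed

lemma bract_compose:
  "(\<And>ys. f ys \<in> W) \<Longrightarrow> bract br x (\<lambda>ys. phi (f ys)) xs = phi (bract br x f xs)"
proof (induction xs arbitrary: f)
  case (Cons y ys)
  have "contract y (\<lambda>ys. phi (f ys)) = (\<lambda>ys. phi (contract y f ys))"
    by (simp add: contract_def)
  then show ?case
    using Cons by (simp add: phi_rules W.bract_in contract_in)
qed (simp add: phi_rules)

text \<open>The bracket part of the Lie derivative commutes with any linear map applied to the
  values; only the action on the values produces a commutator with \<open>phi\<close>.\<close>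

lemma ce_compose:
  "mlin sg sw W f \<Longrightarrow>
    ce br actu (\<lambda>ys. phi (f ys)) xs = phi (ce br act f xs) + cartan (ptw defect) f xs"
proof (induction xs arbitrary: f)
  case (Cons x xs)
  have "contract x (\<lambda>ys. phi (f ys)) = (\<lambda>ys. phi (contract x f ys))"
    by (simp add: contract_def)
  moreover have "lieD br actu x (\<lambda>ys. phi (f ys)) xs = phi (lieD br act x f xs) + defect x (f xs)"
    using Cons.prems
    by (simp add: lieD_def bract_compose mlin_in phi_rules W.act_in W.bract_in defect_def)
  ultimately show ?case
    using Cons.IH[OF mlin_contract[OF Cons.prems], of x]
    unfolding cartan_ptw_Cons cartan.simps(2)[of "lieD _ _"]
    by (simp add: phi_rules mlin_in[OF W.lieD_mlin[OF Cons.prems]]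
        W.ce.cartan_in[OF mlin_contract[OF Cons.prems]])
qed (simp add: phi_rules)

lemma ce_compose_equivariant:
  assumes "\<And>x w. w \<in> W \<Longrightarrow> phi (act x w) = actu x (phi w)" "mlin sg sw W f"
  shows "ce br actu (\<lambda>ys. phi (f ys)) xs = phi (ce br act f xs)"
proof -
  have "cartan (ptw defect) f xs = 0"
    using assms(2)
  proof (induction xs arbitrary: f)
    case (Cons x xs)
    have "defect x (f xs) = 0"
      using assms(1) mlin_in[OF Cons.prems] by (simp add: defect_def)
    then show ?case
      using Cons.IH[OF mlin_contract[OF Cons.prems]] by (simp add: cartan_ptw_Cons del: cartan.simps)
  qed simp
  then show ?thesis using ce_compose[OF assms(2)] by simp
qed

end

section \<open>Families of cochains\<close>

lemma vsubspace_UNIV: "vector_space s \<Longrightarrow> vsubspace s UNIV"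
  by (simp add: vsubspace_def vsubspace_axioms_def module.subspace_UNIV module_iff_vector_space)

lemma length_rem_nth: "i < length xs \<Longrightarrow> length (rem_nth i xs) = length xs - 1"
  by (auto simp: rem_nth_def)

lemma lwedge_scalar:
  assumes "vector_space s"
  shows "lwedge s (\<lambda>ys. if ys = [] then a else 0) f xs = s a (f xs)"
proof (induction xs arbitrary: f)
  case (Cons x xs)
  interpret vsubspace s UNIV
    by (rule vsubspace_UNIV[OF assms])
  have e: "contract x (\<lambda>ys. if ys = [] then a else 0) = (\<lambda>_. 0)"
    "sgnlen (\<lambda>ys. if ys = [] then a else 0) = (\<lambda>ys. if ys = [] then a else 0)"
    by (auto simp: contract_def sgnlen_def)
  show ?case unfolding lwedge.simps e lwedge_zero_left Cons by (simp add: contract_apply)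
qed simp

text \<open>Wedging with a scalar 1-form is the action of the operator-valued 1-form with multiples
  of the identity as values, so the results on \<open>cartan\<close> apply to it.\<close>

lemma lwedge_one_form:
  assumes "vector_space s"
  shows "lwedge s (\<lambda>ys. if length ys = 1 then e (hd ys) else 0) f xs = cartan (ptw (\<lambda>x. s (e x))) f xs"
proof (induction xs arbitrary: f)
  case Nil
  interpret vector_space s by fact
  show ?case by simp
next
  case (Cons x xs)
  interpret vsubspace s UNIV
    by (rule vsubspace_UNIV[OF assms])
  let ?e = "\<lambda>ys. if length ys = 1 then e (hd ys) else 0"
  have 1: "contract x ?e = (\<lambda>ys. if ys = [] then e x else 0)"
    by (auto simp: contract_def)
  have 2: "sgnlen ?e = (\<lambda>ys. - ?e ys)"
    by (auto simp: sgnlen_def sgnp_def)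
  show ?case
    unfolding lwedge.simps 1 2 lwedge_neg_left lwedge_scalar[OF assms] Cons cartan_ptw_Cons by simp
qed

section \<open>Euler's identity for the form degree\<close>

context vsubspace
begin

lemma altl_scale_length:
  "altl sg s W f \<Longrightarrow> altl sg s W (\<lambda>xs. s (k (length xs)) (f xs))"
  by (rule altlI, rule mlinI)
    (simp_all add: closed mlin_in[OF altl_mlin] mlin_lin[OF altl_mlin] altl_adj scale_right_distrib scale_left_commute)

lemma mlin_sum_hd:
  assumes "vector_space sg" "mlin sg s W f" "finite B"
  shows "f ((\<Sum>b\<in>B. sg (c b) b) # vs) = (\<Sum>b\<in>B. s (c b) (f (b # vs)))"
  using assms(3)
proof (induction B)
  case empty
  show ?case using mlin_slot_zero[OF assms(1,2), of "[]"] by simp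
next
  case (insert b B)
  then show ?case using mlin_lin_hd[OF assms(2)] by simp
qed

lemma scalar_form:
  assumes "vector_space sg" "lin_on sg (*) UNIV e"
  shows "op_form sg s W s W (\<lambda>x. s (e x))"
proof -
  interpret sg: vector_space sg by fact
  show ?thesis
    by unfold_locales
      (use assms(2) in \<open>auto simp: closed lin_on_def scale_right_distrib scale_left_distrib scale_left_commute\<close>)
qed

text \<open>In usual notation: the sum of e^b wedge i_b f is p f for f of degree p. Contracting with
  x gives the sum of e^b(x) i_b f, which is i_x f, minus the sum of e^b wedge i_x i_b f. Exchanging
  i_x and i_b turns the latter into the induction hypothesis for i_x f, so the factor is 1 + (p -
  1).\<close>

lemma euler_identity:
  assumes sg: "vector_space sg" and fin: "finite B"
    and lin: "\<And>b. b \<in> B \<Longrightarrow> lin_on sg (*) UNIV (e b)"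
    and exp: "\<And>x. (\<Sum>b\<in>B. sg (e b x) b) = x"
  shows "altl sg s W f \<Longrightarrow>
    (\<Sum>b\<in>B. cartan (ptw (\<lambda>x. s (e b x))) (contract b f) xs) = s (of_nat (length xs)) (f xs)"
proof (induction xs arbitrary: f)
  case (Cons x xs)
  note m = altl_mlin[OF Cons.prems]
  have "cartan (ptw (\<lambda>x. s (e b x))) (contract x (contract b f)) xs =
      - cartan (ptw (\<lambda>x. s (e b x))) (contract b (contract x f)) xs" if "b \<in> B" for b
  proof -
    interpret op_form sg s W s W "\<lambda>x. s (e b x)"
      using scalar_form[OF sg lin[OF that]] .
    have "contract x (contract b f) = (\<lambda>ys. - contract b (contract x f) ys)"
      by (rule ext) (simp only: contract_apply altl_swap_hd[OF sg Cons.prems, of b x])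
    then show ?thesis using cartan_neg[OF mlin_contract[OF mlin_contract[OF m]]] by simp
  qed
  then have "(\<Sum>b\<in>B. cartan (ptw (\<lambda>x. s (e b x))) (contract b f) (x # xs)) =
      (\<Sum>b\<in>B. s (e b x) (f (b # xs)) + cartan (ptw (\<lambda>x. s (e b x))) (contract b (contract x f)) xs)"
    by (intro sum.cong) (simp_all add: cartan_ptw_Cons contract_apply[of _ f] del: cartan.simps)
  also have "\<dots> = f (x # xs) + s (of_nat (length xs)) (contract x f xs)"
    unfolding sum.distrib Cons.IH[OF altl_contract[OF Cons.prems]]
      mlin_sum_hd[OF sg m fin, symmetric] exp ..
  also have "\<dots> = s (of_nat (length (x # xs))) (f (x # xs))"
    by (simp add: contract_apply scale_left_distrib)
  finally show ?case .
qed simp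

end

text \<open>A member of \<open>Omega\<close> vanishes on lists of the wrong length, so its index p
  carries no information; on \<open>Omega\<close> this map and \<open>unflatten\<close> are mutually
  inverse.\<close>

definition flatten :: "(nat \<Rightarrow> nat \<Rightarrow> 'g list \<Rightarrow> 'w) \<Rightarrow> nat \<Rightarrow> 'g list \<Rightarrow> 'w" where
  "flatten c q xs = c (length xs) q xs"

definition unflatten :: "(nat \<Rightarrow> 'g list \<Rightarrow> 'w::zero) \<Rightarrow> nat \<Rightarrow> nat \<Rightarrow> 'g list \<Rightarrow> 'w" where
  "unflatten F p q xs = (if length xs = p then F q xs else 0)"

lemma flatten_unflatten [simp]: "flatten (unflatten F) = F"
  by (intro ext) (simp add: flatten_def unflatten_def)

lemma flatten_oadd: "flatten (oadd c c') = (\<lambda>q xs. flatten c q xs + flatten c' q xs)"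
  and flatten_osub: "flatten (osub c c') = (\<lambda>q xs. flatten c q xs - flatten c' q xs)"
  by (intro ext; simp add: flatten_def oadd_def osub_def)+

lemma unflatten_add: "oadd (unflatten F) (unflatten G) = unflatten (\<lambda>q xs. F q xs + G q xs)"
  and unflatten_diff: "osub (unflatten F) (unflatten G) = unflatten (\<lambda>q xs. F q xs - G q xs)"
  by (intro ext; simp add: unflatten_def oadd_def osub_def)+

lemma Omega_unflatten_flatten: "c \<in> Omega sg sw Wc \<Longrightarrow> unflatten (flatten c) = c"
  by (intro ext) (auto simp: flatten_def unflatten_def Omega_def alt_map_def)

lemma Omega_altl:
  assumes "c \<in> Omega sg sw Wc"
  shows "altl sg sw (Wc q) (flatten c q)"
proof -
  have a: "alt_map sg sw (Wc q) p (c p q)" for p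
    using assms by (simp add: Omega_def)
  show ?thesis
  proof (rule altlI, rule mlinI)
    show "flatten c q xs \<in> Wc q" for xs
      using a[of "length xs"] by (simp add: alt_map_def flatten_def)
    show "flatten c q (us @ (sg x y + z) # vs) = sw x (flatten c q (us @ y # vs)) + flatten c q (us @ z # vs)"
      for us x y z vs
    proof -
      have "\<forall>xs i x y z. length xs = Suc (length us + length vs) \<and> i < Suc (length us + length vs) \<longrightarrow>
          c (Suc (length us + length vs)) q (xs[i := sg x y + z]) =
          sw x (c (Suc (length us + length vs)) q (xs[i := y])) + c (Suc (length us + length vs)) q (xs[i := z])"
        using a[of "Suc (length us + length vs)"] by (simp add: alt_map_def)
      from this[rule_format, of "us @ z # vs" "length us" x y z]
      show ?thesis by (simp add: flatten_def)
    qed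
    show "flatten c q (us @ x # x # vs) = 0" for us x vs
    proof -
      let ?xs = "us @ x # x # vs"
      have "\<forall>i j. i < j \<and> j < length ?xs \<and> ?xs ! i = ?xs ! j \<longrightarrow> c (length ?xs) q ?xs = 0"
        using a[of "length ?xs"] unfolding alt_map_def by blast
      from this[rule_format, of "length us" "Suc (length us)"]
      show ?thesis by (simp add: flatten_def nth_append)
    qed
  qed
qed

lemma unflatten_Omega:
  fixes sg :: "'a::field \<Rightarrow> 'g::ab_group_add \<Rightarrow> 'g"
  assumes "vector_space sg" "\<And>q. vsubspace sw (Wc q)" "\<And>q. altl sg sw (Wc q) (F q)"
  shows "unflatten F \<in> Omega sg sw Wc"
  unfolding Omega_def mem_Collect_eq
proof (intro allI)
  fix p q
  interpret vsubspace sw "Wc q" by (rule assms(2))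
  note A = assms(3)[of q] and m = altl_mlin[OF assms(3)[of q]]
  show "alt_map sg sw (Wc q) p (unflatten F p q)"
    unfolding alt_map_def
  proof (intro conjI allI impI)
    fix xs :: "'g list" and i a y z
    assume "length xs = p \<and> i < p"
    then show "unflatten F p q (xs[i := sg a y + z]) = sw a (unflatten F p q (xs[i := y])) + unflatten F p q (xs[i := z])"
      by (simp add: unflatten_def upd_conv_take_nth_drop mlin_lin[OF m])
  next
    fix xs :: "'g list" and i j
    assume *: "length xs = p \<and> i < j \<and> j < p \<and> xs ! i = xs ! j"
    define ys where "ys = drop (Suc i) xs"
    have 1: "xs = take i xs @ xs ! i # ys"
      unfolding ys_def using * by (intro id_take_nth_drop) simp
    have 2: "ys = take (j - Suc i) ys @ ys ! (j - Suc i) # drop (Suc (j - Suc i)) ys"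
      using * by (intro id_take_nth_drop) (simp add: ys_def, linarith)
    have "ys ! (j - Suc i) = xs ! i"
      using * by (simp add: ys_def)
    then have "F q (take i xs @ xs ! i # ys) = 0"
      using altl_repeat[OF assms(1) A] 2 by metis
    with 1 show "unflatten F p q xs = 0" by (simp add: unflatten_def)
  qed (auto simp: unflatten_def mlin_in[OF m])
qed

lemma dW_eq: "dW d c = unflatten (\<lambda>q xs. if q = 0 then 0 else sgnp (length xs) (d (q - 1) (flatten c (q - 1) xs)))"
  by (intro ext) (simp add: dW_def unflatten_def flatten_def)

lemma dCE_eq:
  assumes "\<And>q. lie_mod sg br sw act (Wc q)" "c \<in> Omega sg sw Wc"
  shows "dCE br act c = unflatten (\<lambda>q. ce br act (flatten c q))"
proof (intro ext)
  fix p q xs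
  interpret lie_mod sg br sw act "Wc q" by (rule assms(1))
  show "dCE br act c p q xs = unflatten (\<lambda>q. ce br act (flatten c q)) p q xs"
  proof (cases "length xs = p \<and> p \<noteq> 0")
    case True
    have "(\<Sum>i<p. sgnp i (act (xs ! i) (c (p - 1) q (rem_nth i xs)))) =
        (\<Sum>i<p. sgnp i (act (xs ! i) (flatten c q (rem_nth i xs))))"
      using True by (intro sum.cong) (auto simp: flatten_def length_rem_nth)
    moreover have "(\<Sum>j<p. \<Sum>i<j. sgnp (i + j) (c (p - 1) q (br (xs ! i) (xs ! j) # rem_nth i (rem_nth j xs)))) =
        (\<Sum>j<p. \<Sum>i<j. sgnp (i + j) (flatten c q (br (xs ! i) (xs ! j) # rem_nth i (rem_nth j xs))))"
    proof (intro sum.cong refl)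
      fix j i assume "j \<in> {..<p}" "i \<in> {..<j}"
      then have "length (br (xs ! i) (xs ! j) # rem_nth i (rem_nth j xs)) = p - 1"
        using True by (simp add: length_rem_nth)
      then show "sgnp (i + j) (c (p - 1) q (br (xs ! i) (xs ! j) # rem_nth i (rem_nth j xs))) =
          sgnp (i + j) (flatten c q (br (xs ! i) (xs ! j) # rem_nth i (rem_nth j xs)))"
        by (simp only: flatten_def)
    qed
    ultimately show ?thesis
      using True ce_eq_sum[OF Omega_altl[OF assms(2), of q], of xs] by (simp add: dCE_def unflatten_def)
  qed (auto simp: dCE_def unflatten_def)
qed

definition flatK :: "(nat \<Rightarrow> 'g list \<Rightarrow> 'a) \<Rightarrow> 'g list \<Rightarrow> 'a" where
  "flatK eta xs = eta (length xs) xs"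

lemma flatK_par: "flatK (par eta) = sgnlen (flatK eta)"
  by (rule ext) (simp add: flatK_def par_def sgnlen_def sgnp_def)

lemma wedge_eq:
  fixes sw :: "'a::field \<Rightarrow> 'w::ab_group_add \<Rightarrow> 'w" and eta :: "nat \<Rightarrow> 'g list \<Rightarrow> 'a"
  shows "wedge sw eta c = unflatten (\<lambda>q. lwedge sw (flatK eta) (flatten c q))"
proof (intro ext)
  fix p q and xs :: "'g list"
  have "wedge sw eta c (length xs) q xs = lwedge sw (flatK eta) (flatten c q) xs"
    unfolding shuffle_sum_eq_lwedge[symmetric] wedge_def
    by (auto simp: flatten_def flatK_def intro!: sum.cong)
  then show "wedge sw eta c p q xs = unflatten (\<lambda>q. lwedge sw (flatK eta) (flatten c q)) p q xs"
    by (auto simp: unflatten_def wedge_def)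
qed

lemma flatten_wedge:
  fixes sw :: "'a::field \<Rightarrow> 'w::ab_group_add \<Rightarrow> 'w"
  shows "flatten (wedge sw eta c) q = lwedge sw (flatK eta) (flatten c q)"
  by (simp add: wedge_eq)

lemma hom_deg_iff:
  "c \<in> Omega sg sw Wc \<Longrightarrow> hom_deg n c \<longleftrightarrow> (\<forall>q xs. int (length xs) + int q \<noteq> n \<longrightarrow> flatten c q xs = 0)"
  by (auto simp: hom_deg_def flatten_def fun_eq_iff Omega_def alt_map_def) metis

lemma hom_deg_unflatten:
  "hom_deg n (unflatten F) \<longleftrightarrow> (\<forall>q xs. int (length xs) + int q \<noteq> n \<longrightarrow> F q xs = 0)"
  by (auto simp: hom_deg_def unflatten_def fun_eq_iff)

section \<open>Linear maps over the forms, and homotopies\<close>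

lemma flatten_wedge_fun:
  fixes sw :: "'a::field \<Rightarrow> 'w::ab_group_add \<Rightarrow> 'w"
  shows "flatten (wedge sw eta c) = (\<lambda>q. lwedge sw (flatK eta) (flatten c q))"
  by (rule ext) (rule flatten_wedge)

text \<open>Transfers \<Omega>-linearity to flattened cochains, where inductions on lists apply. For
  odd k the sign \<open>sgnlen e\<close> is the flattened form of \<open>par\<close>.\<close>

lemma omega_map_flatI:
  fixes sg :: "'a::field \<Rightarrow> 'g::ab_group_add \<Rightarrow> 'g"
    and sw :: "'a \<Rightarrow> 'w::ab_group_add \<Rightarrow> 'w" and su :: "'a \<Rightarrow> 'u::ab_group_add \<Rightarrow> 'u"
  assumes vs: "vector_space sg" "\<And>q. vsubspace su (Uc q)"
    and alt: "\<And>F q. (\<And>q. altl sg sw (Wc q) (F q)) \<Longrightarrow> altl sg su (Uc q) (\<Psi> F q)"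
    and add: "\<And>F G q xs. (\<And>q. altl sg sw (Wc q) (F q)) \<Longrightarrow> (\<And>q. altl sg sw (Wc q) (G q)) \<Longrightarrow>
      \<Psi> (\<lambda>q xs. F q xs + G q xs) q xs = \<Psi> F q xs + \<Psi> G q xs"
    and wedge: "\<And>F e q xs. (\<And>q. altl sg sw (Wc q) (F q)) \<Longrightarrow>
      \<Psi> (\<lambda>q. lwedge sw e (F q)) q xs = lwedge su (if even k then e else sgnlen e) (\<Psi> F q) xs"
    and deg: "\<And>F n q xs. (\<And>q. altl sg sw (Wc q) (F q)) \<Longrightarrow>
      (\<And>q xs. int (length xs) + int q \<noteq> n \<Longrightarrow> F q xs = 0) \<Longrightarrow>
      int (length xs) + int q \<noteq> n + k \<Longrightarrow> \<Psi> F q xs = 0"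
  shows "omega_map sg sw su Wc Uc k (\<lambda>c. unflatten (\<Psi> (flatten c)))"
  unfolding omega_map_def
proof (intro conjI ballI allI impI)
  fix c assume "c \<in> Omega sg sw Wc"
  then show "unflatten (\<Psi> (flatten c)) \<in> Omega sg su Uc"
    by (intro unflatten_Omega vs alt Omega_altl)
next
  fix c c' assume "c \<in> Omega sg sw Wc" "c' \<in> Omega sg sw Wc"
  then have "\<Psi> (flatten (oadd c c')) = (\<lambda>q xs. \<Psi> (flatten c) q xs + \<Psi> (flatten c') q xs)"
    unfolding flatten_oadd by (intro ext add Omega_altl)
  then show "unflatten (\<Psi> (flatten (oadd c c'))) =
      oadd (unflatten (\<Psi> (flatten c))) (unflatten (\<Psi> (flatten c')))"
    by (simp add: unflatten_add)
next
  fix eta c assume c: "c \<in> Omega sg sw Wc"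
  have "\<Psi> (flatten (wedge sw eta c)) q xs =
      lwedge su (flatK (if even k then eta else par eta)) (\<Psi> (flatten c) q) xs" for q xs
    unfolding flatten_wedge_fun using wedge[OF Omega_altl[OF c]] by (simp add: flatK_par)
  then show "unflatten (\<Psi> (flatten (wedge sw eta c))) =
      wedge su (if even k then eta else par eta) (unflatten (\<Psi> (flatten c)))"
    unfolding wedge_eq flatten_unflatten by (intro arg_cong[where f = unflatten] ext) auto
next
  fix n c assume c: "c \<in> Omega sg sw Wc" and "hom_deg n c"
  then show "hom_deg (n + k) (unflatten (\<Psi> (flatten c)))"
    unfolding hom_deg_iff[OF c] hom_deg_unflatten by (intro allI impI deg[OF Omega_altl[OF c]]) auto
qed

lemma omega_mapD:
  assumes "omega_map sg sw su Wc Uc k F" "c \<in> Omega sg sw Wc"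
  shows "F c \<in> Omega sg su Uc"
    and "c' \<in> Omega sg sw Wc \<Longrightarrow> F (oadd c c') = oadd (F c) (F c')"
    and "eta \<in> OmegaK sg \<Longrightarrow> F (wedge sw eta c) = wedge su (if even k then eta else par eta) (F c)"
    and "hom_deg n c \<Longrightarrow> hom_deg (n + k) (F c)"
  using assms by (auto simp: omega_map_def)

lemma par_OmegaK:
  assumes "eta \<in> OmegaK sg"
  shows "par eta \<in> OmegaK sg"
proof -
  have "alt_map sg (*) UNIV r (par eta r)" for r
  proof -
    have "alt_map sg (*) UNIV r (eta r)" using assms by (simp add: OmegaK_def)
    moreover have "par eta r = (\<lambda>xs. sgnp r (eta r xs))" by (rule ext) (simp add: par_def sgnp_def)
    ultimately show ?thesis by (simp add: alt_map_def sgnp_def)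
  qed
  then show ?thesis by (simp add: OmegaK_def)
qed

lemma omega_map_comp:
  assumes "omega_map sg sw su Wc Uc k F" "omega_map sg su st Uc Tc 0 G"
  shows "omega_map sg sw st Wc Tc k (\<lambda>c. G (F c))"
  unfolding omega_map_def
proof (intro conjI ballI allI impI)
  fix c assume c: "c \<in> Omega sg sw Wc"
  note F = omega_mapD[OF assms(1) c] and G = omega_mapD[OF assms(2) omega_mapD(1)[OF assms(1) c]]
  show "G (F c) \<in> Omega sg st Tc" by (rule G)
  show "G (F (oadd c c')) = oadd (G (F c)) (G (F c'))" if "c' \<in> Omega sg sw Wc" for c'
    using F(2)[OF that] G(2)[OF omega_mapD(1)[OF assms(1) that]] by simp
  show "G (F (wedge sw eta c)) = wedge st (if even k then eta else par eta) (G (F c))"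
    if "eta \<in> OmegaK sg" for eta
    using F(3)[OF that] G(3)[OF that] G(3)[OF par_OmegaK[OF that]] by simp
  show "hom_deg (n + k) (G (F c))" if "hom_deg n c" for n
    using G(4)[OF F(4)[OF that]] by simp
qed

section \<open>Differences of linear maps, and homotopy as an equivalence relation\<close>

lemma wedge_osub:
  fixes su :: "'a::field \<Rightarrow> 'u::ab_group_add \<Rightarrow> 'u"
  assumes "vector_space su"
  shows "wedge su eta (osub c c') = osub (wedge su eta c) (wedge su eta c')"
proof -
  interpret vsubspace su UNIV by (rule vsubspace_UNIV[OF assms])
  show ?thesis
    unfolding wedge_eq unflatten_diff flatten_osub
    by (intro arg_cong[where f = unflatten] ext lwedge_diff_right)
qed

lemma osub_Omega:
  assumes "vector_space sg" "\<And>q. vsubspace su (Uc q)" "c \<in> Omega sg su Uc" "c' \<in> Omega sg su Uc"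
  shows "osub c c' \<in> Omega sg su Uc"
proof -
  have "osub c c' = unflatten (\<lambda>q xs. flatten c q xs - flatten c' q xs)"
    using Omega_unflatten_flatten[OF assms(3)] Omega_unflatten_flatten[OF assms(4)]
    by (metis unflatten_diff)
  also have "\<dots> \<in> Omega sg su Uc"
    by (intro unflatten_Omega assms(1,2) vsubspace.altl_diff Omega_altl assms(3,4))
  finally show ?thesis .
qed

lemma omega_map_osub:
  assumes "vector_space sg" "\<And>q. vsubspace su (Uc q)"
    "omega_map sg sw su Wc Uc k F" "omega_map sg sw su Wc Uc k G"
  shows "omega_map sg sw su Wc Uc k (\<lambda>c. osub (F c) (G c))"
  unfolding omega_map_def
proof (intro conjI ballI allI impI)
  have su: "vector_space su" using assms(2)[of 0] by (simp add: vsubspace_def)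
  fix c assume c: "c \<in> Omega sg sw Wc"
  note F = omega_mapD[OF assms(3) c] and G = omega_mapD[OF assms(4) c]
  show "osub (F c) (G c) \<in> Omega sg su Uc" by (intro osub_Omega assms F G)
  show "osub (F (oadd c c')) (G (oadd c c')) = oadd (osub (F c) (G c)) (osub (F c') (G c'))"
    if "c' \<in> Omega sg sw Wc" for c'
    unfolding F(2)[OF that] G(2)[OF that] by (simp add: osub_def oadd_def algebra_simps)
  show "osub (F (wedge sw eta c)) (G (wedge sw eta c)) = wedge su (if even k then eta else par eta) (osub (F c) (G c))"
    if "eta \<in> OmegaK sg" for eta
    unfolding F(3)[OF that] G(3)[OF that] wedge_osub[OF su] ..
  show "hom_deg (n + k) (osub (F c) (G c))" if "hom_deg n c" for n
    using F(4)[OF that] G(4)[OF that] by (simp add: hom_deg_def osub_def)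
qed

lemma omega_map_zero:
  fixes sg :: "'a::field \<Rightarrow> 'g::ab_group_add \<Rightarrow> 'g" and su :: "'a \<Rightarrow> 'u::ab_group_add \<Rightarrow> 'u"
  assumes "vector_space sg" "\<And>q. vsubspace su (Uc q)"
  shows "omega_map sg sw su Wc Uc k (\<lambda>c. unflatten (\<lambda>_ _. 0))"
proof -
  have "vsubspace su UNIV" using assms(2)[of 0] by (simp add: vsubspace_def vsubspace_UNIV[unfolded vsubspace_def])
  then interpret vsubspace su UNIV .
  show ?thesis
    by (rule omega_map_flatI[where \<Psi> = "\<lambda>_ _ _. 0"])
      (auto simp: assms vsubspace.altl_zero lwedge_zero_right)
qed

lemma dCE_osub:
  assumes m: "\<And>q. lie_mod sg br sw act (Wc q)" and c: "c \<in> Omega sg sw Wc" "c' \<in> Omega sg sw Wc"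
  shows "dCE br act (osub c c') = osub (dCE br act c) (dCE br act c')"
proof -
  interpret lie_mod sg br sw act "Wc q" for q by (rule m)
  have o: "osub c c' \<in> Omega sg sw Wc"
    by (intro osub_Omega vsg W.vsubspace_axioms c)
  show ?thesis
    unfolding dCE_eq[OF m c(1)] dCE_eq[OF m c(2)] dCE_eq[OF m o] unflatten_diff flatten_osub
    by (intro arg_cong[where f = unflatten] ext
        ce.cartan_diff[OF altl_mlin[OF Omega_altl[OF c(1)]] altl_mlin[OF Omega_altl[OF c(2)]]])
qed

lemma gcar_lie_mod:
  assumes "lie_algebra sg br"
  shows "lie_mod sg br sg br (gcar q)"
proof -
  interpret lie_alg sg br by unfold_locales fact
  have "lie_module_on sg br sg br (gcar q)"
    unfolding lie_module_on_def
    using vsg by (auto simp: gcar_def lin_on_def br_lin1 br_lin2 br_zero2 jacobi sg.subspace_UNIV sg.subspace_single_0)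
  then show ?thesis by unfold_locales
qed

lemma homotopic_agree:
  assumes lie: "lie_algebra sg br" and "\<And>c. c \<in> Omega sg sv Vc \<Longrightarrow> alpha c = alpha' c"
  shows "homotopic sg br sv act Vc d alpha alpha'"
proof -
  interpret g: lie_mod sg br sg br "gcar q" for q by (rule gcar_lie_mod[OF lie])
  have z: "unflatten (\<lambda>_ _. 0) \<in> Omega sg sg gcar"
    by (intro unflatten_Omega g.vsg g.W.vsubspace_axioms g.W.altl_zero)
  have "dCE br br (unflatten (\<lambda>_ _. 0)) = (unflatten (\<lambda>_ _. 0) :: nat \<Rightarrow> nat \<Rightarrow> 'b list \<Rightarrow> 'b)"
    unfolding dCE_eq[OF gcar_lie_mod[OF lie] z] flatten_unflatten
    by (intro arg_cong[where f = unflatten] ext g.ce.cartan_zero)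
  then have "osub (alpha' c) (alpha c) =
      oadd (dCE br br (unflatten (\<lambda>_ _. 0))) (unflatten (\<lambda>_ _. 0))" if "c \<in> Omega sg sv Vc" for c
    using assms(2)[OF that] by (simp add: osub_def oadd_def unflatten_def)
  then show ?thesis
    unfolding homotopic_def
    using omega_map_zero[OF g.vsg g.W.vsubspace_axioms] by (intro exI[where x = "\<lambda>_. unflatten (\<lambda>_ _. 0)"]) auto
qed

text \<open>The difference of two homotopies out of \<open>beta\<close> is a homotopy between their
  targets. Together with reflexivity this form yields both symmetry and transitivity.\<close>

lemma homotopic_join:
  assumes lie: "lie_algebra sg br"
    and 1: "homotopic sg br sv act Vc d beta alpha" and 2: "homotopic sg br sv act Vc d beta alpha'"
  shows "homotopic sg br sv act Vc d alpha alpha'"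
proof -
  interpret g: lie_mod sg br sg br "gcar q" for q by (rule gcar_lie_mod[OF lie])
  obtain h where h: "omega_map sg sv sg Vc gcar (-1) h"
    "\<And>c. c \<in> Omega sg sv Vc \<Longrightarrow> osub (alpha c) (beta c) = oadd (dCE br br (h c)) (h (dtot br act d c))"
    using 1 by (auto simp: homotopic_def)
  obtain h' where h': "omega_map sg sv sg Vc gcar (-1) h'"
    "\<And>c. c \<in> Omega sg sv Vc \<Longrightarrow> osub (alpha' c) (beta c) = oadd (dCE br br (h' c)) (h' (dtot br act d c))"
    using 2 by (auto simp: homotopic_def)
  have "osub (alpha' c) (alpha c) =
      oadd (dCE br br (osub (h' c) (h c))) (osub (h' (dtot br act d c)) (h (dtot br act d c)))"
    if c: "c \<in> Omega sg sv Vc" for c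
  proof -
    have "osub (alpha' c) (alpha c) = osub (osub (alpha' c) (beta c)) (osub (alpha c) (beta c))"
      by (simp add: osub_def)
    also have "\<dots> = oadd (osub (dCE br br (h' c)) (dCE br br (h c))) (osub (h' (dtot br act d c)) (h (dtot br act d c)))"
      unfolding h(2)[OF c] h'(2)[OF c] by (simp add: osub_def oadd_def algebra_simps)
    finally show ?thesis
      unfolding dCE_osub[OF gcar_lie_mod[OF lie] omega_mapD(1)[OF h'(1) c] omega_mapD(1)[OF h(1) c]] .
  qed
  then show ?thesis
    unfolding homotopic_def
    using omega_map_osub[OF g.vsg g.W.vsubspace_axioms h'(1) h(1)]
    by (intro exI[where x = "\<lambda>c. osub (h' c) (h c)"]) auto
qed

lemma homotopic_sym:
  "lie_algebra sg br \<Longrightarrow> homotopic sg br sv act Vc d alpha alpha' \<Longrightarrow> homotopic sg br sv act Vc d alpha' alpha"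
  using homotopic_join homotopic_agree by metis

lemma homotopic_trans:
  "lie_algebra sg br \<Longrightarrow> homotopic sg br sv act Vc d alpha beta \<Longrightarrow> homotopic sg br sv act Vc d beta gamma
    \<Longrightarrow> homotopic sg br sv act Vc d alpha gamma"
  using homotopic_join homotopic_sym by metis

section \<open>The contraction and its perturbation\<close>

lemma sgnlen_add: "sgnlen (\<lambda>xs. f xs + g xs) xs = sgnlen f xs + sgnlen g xs"
  by (simp add: sgnlen_def sgnp_add)

text \<open>The contraction identity is imposed in positive degrees only. In degree 0 it is replaced
  by the projection 1 - s d onto ker d_0: applied to d v, the identity gives d s d v = d v.\<close>

locale dg_contraction = lie_alg sg br
  for sg :: "'a::field \<Rightarrow> 'g::ab_group_add \<Rightarrow> 'g" and br :: "'g \<Rightarrow> 'g \<Rightarrow> 'g" +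
  fixes sv :: "'a \<Rightarrow> 'v::ab_group_add \<Rightarrow> 'v" and act :: "'g \<Rightarrow> 'v \<Rightarrow> 'v" and Vc :: "nat \<Rightarrow> 'v set"
    and d :: "nat \<Rightarrow> 'v \<Rightarrow> 'v" and s :: "nat \<Rightarrow> 'v \<Rightarrow> 'v"
  assumes dg: "dg_module sg br sv act Vc d"
    and s_lin: "lin_on sv sv (Vc (Suc q)) (s q)"
    and s_in: "v \<in> Vc (Suc q) \<Longrightarrow> s q v \<in> Vc q"
    and s_homotopy: "v \<in> Vc (Suc q) \<Longrightarrow> d q (s q v) + s (Suc q) (d (Suc q) v) = v"
begin

lemma d_lin: "lin_on sv sv (Vc q) (d q)" and d_in: "v \<in> Vc q \<Longrightarrow> d q v \<in> Vc (Suc q)"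
  and d_act: "v \<in> Vc q \<Longrightarrow> d q (act x v) = act x (d q v)"
  and d_d: "v \<in> Vc q \<Longrightarrow> d (Suc q) (d q v) = 0"
  and V_mod: "lie_module_on sg br sv act (Vc q)"
  using dg by (auto simp: dg_module_def)

lemma V_lie_mod: "lie_mod sg br sv act (Vc q)"
  by unfold_locales (rule V_mod)

sublocale V: lie_mod sg br sv act "Vc q" for q
  by (rule V_lie_mod)

sublocale S: lie_mod_pair sg br sv act "Vc (Suc q)" sv act "Vc q" "s q" for q
  by unfold_locales (simp_all add: s_lin s_in)

lemmas s_rules = lin_on_rules[OF s_lin V.W.vsubspace_axioms V.W.vector_space_axioms]
lemmas d_rules = lin_on_rules[OF d_lin V.W.vsubspace_axioms V.W.vector_space_axioms]

abbreviation "cochains F \<equiv> \<forall>q. altl sg sv (Vc q) (F q)"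

text \<open>The sign (-1)^p is the Koszul sign that makes the extension of \<open>s\<close> to
  cochains \<Omega>-linear of degree -1.\<close>

definition flat_htpy :: "(nat \<Rightarrow> 'g list \<Rightarrow> 'v) \<Rightarrow> nat \<Rightarrow> 'g list \<Rightarrow> 'v" where
  "flat_htpy F q xs = s q (sgnlen (F (Suc q)) xs)"

definition flat_dtot :: "(nat \<Rightarrow> 'g list \<Rightarrow> 'v) \<Rightarrow> nat \<Rightarrow> 'g list \<Rightarrow> 'v" where
  "flat_dtot F q xs = ce br act (F q) xs + (case q of 0 \<Rightarrow> 0 | Suc r \<Rightarrow> d r (sgnlen (F r) xs))"

text \<open>The second summand of the following map is minus the anticommutator of \<^term>\<open>flat_htpy\<close> with
  the Chevalley--Eilenberg differential. It raises the form degree and lowers the degree in \<open>V\<close>,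
  hence is nilpotent.\<close>

definition flat_proj :: "(nat \<Rightarrow> 'g list \<Rightarrow> 'v) \<Rightarrow> nat \<Rightarrow> 'g list \<Rightarrow> 'v" where
  "flat_proj F q xs = (if q = 0 then F 0 xs - s 0 (d 0 (F 0 xs)) else 0)
     - cartan (ptw (S.defect q)) (sgnlen (F (Suc q))) xs"

lemma cochains_in: "cochains F \<Longrightarrow> F q xs \<in> Vc q"
  using altl_mlin mlin_in by blast

lemma cochains_sgnlen: "cochains F \<Longrightarrow> altl sg sv (Vc q) (sgnlen (F q))"
  by (simp add: V.W.altl_sgnlen[OF vsg])

lemma sgnlen_in: "cochains F \<Longrightarrow> sgnlen (F q) xs \<in> Vc q"
  using cochains_sgnlen altl_mlin mlin_in by blast

lemma flat_htpy_altl: "cochains F \<Longrightarrow> altl sg sv (Vc q) (flat_htpy F q)"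
  using V.W.altl_compose[OF V.W.vsubspace_axioms s_lin s_in cochains_sgnlen]
  by (simp add: flat_htpy_def[abs_def])

lemma d_sgnlen_altl: "cochains F \<Longrightarrow> altl sg sv (Vc (Suc r)) (\<lambda>xs. d r (sgnlen (F r) xs))"
  by (rule V.W.altl_compose[OF V.W.vsubspace_axioms d_lin d_in cochains_sgnlen])

lemma flat_dtot_0: "flat_dtot F 0 = ce br act (F 0)"
  and flat_dtot_Suc: "flat_dtot F (Suc r) = (\<lambda>xs. ce br act (F (Suc r)) xs + d r (sgnlen (F r) xs))"
  by (simp_all add: flat_dtot_def[abs_def])

lemma flat_dtot_altl: "cochains F \<Longrightarrow> altl sg sv (Vc q) (flat_dtot F q)"
proof (cases q)
  case 0
  assume "cochains F"
  then show ?thesis using 0 by (simp add: flat_dtot_0 V.ce.cartan_altl)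
next
  case (Suc r)
  assume F: "cochains F"
  then have "altl sg sv (Vc (Suc r)) (ce br act (F (Suc r)))"
    by (simp add: V.ce.cartan_altl)
  then show ?thesis
    unfolding Suc flat_dtot_Suc by (rule V.W.altl_add[OF vsg _ d_sgnlen_altl[OF F]])
qed

lemma cochains_mlin: "cochains F \<Longrightarrow> mlin sg sv (Vc q) (F q)"
  using altl_mlin by blast

text \<open>The terms in which \<open>s\<close> is applied to the Chevalley-Eilenberg differential
  cancel, since that differential reverses the sign in \<open>flat_htpy\<close>. What is left is s d
  and the commutator of \<open>s\<close> with the action.\<close>

lemma ce_flat_htpy:
  assumes F: "cochains F"
  shows "ce br act (flat_htpy F q) xs + flat_htpy (flat_dtot F) q xs =
    s q (d q (F q xs)) + cartan (ptw (S.defect q)) (sgnlen (F (Suc q))) xs"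
proof -
  let ?f = "F (Suc q)"
  have m: "mlin sg sv (Vc (Suc q)) (sgnlen ?f)" by (rule altl_mlin[OF cochains_sgnlen[OF F]])
  have c: "ce br act ?f xs \<in> Vc (Suc q)" by (rule V.ce.cartan_in[OF cochains_mlin[OF F]])
  have "ce br act (flat_htpy F q) xs = s q (ce br act (sgnlen ?f) xs) + cartan (ptw (S.defect q)) (sgnlen ?f) xs"
    using S.ce_compose[OF m] by (simp add: flat_htpy_def[abs_def])
  also have "ce br act (sgnlen ?f) xs = - sgnp (length xs) (ce br act ?f xs)"
    using V.ce_sgnlen[OF cochains_mlin[OF F]] by (simp add: sgnlen_def)
  also have "s q \<dots> = - sgnp (length xs) (s q (ce br act ?f xs))"
    using c by (simp add: s_rules V.W.closed)
  finally have 1: "ce br act (flat_htpy F q) xs =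
      - sgnp (length xs) (s q (ce br act ?f xs)) + cartan (ptw (S.defect q)) (sgnlen ?f) xs" .
  have "flat_htpy (flat_dtot F) q xs = sgnp (length xs) (s q (ce br act ?f xs)) + s q (d q (F q xs))"
    using c cochains_in[OF F, of q xs]
    unfolding flat_htpy_def flat_dtot_Suc sgnlen_add by (simp add: sgnlen_def d_rules s_rules d_in V.W.closed)
  with 1 show ?thesis by simp
qed

text \<open>In positive degree d s + s d = 1 cancels the identity. In degree 0 there is no summand d
  s, so 1 - s d survives.\<close>

lemma flat_proj_eq:
  assumes F: "cochains F"
  shows "flat_proj F q xs = F q xs - (flat_dtot (flat_htpy F) q xs + flat_htpy (flat_dtot F) q xs)"
proof (cases q)
  case 0
  then show ?thesis using ce_flat_htpy[OF F, of 0 xs] by (simp add: flat_proj_def flat_dtot_0)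
next
  case (Suc r)
  have "d r (sgnlen (flat_htpy F r) xs) = d r (s r (F (Suc r) xs))"
    using cochains_in[OF F, of "Suc r" xs] s_in
    by (simp add: sgnlen_def flat_htpy_def s_rules d_rules V.W.closed)
  then show ?thesis
    using ce_flat_htpy[OF F, of "Suc r" xs] s_homotopy[OF cochains_in[OF F, of "Suc r" xs]] Suc
    by (simp add: flat_proj_def flat_dtot_Suc algebra_simps)
qed

lemma flat_proj_altl:
  assumes F: "cochains F"
  shows "altl sg sv (Vc q) (flat_proj F q)"
proof -
  have "flat_proj F q = (\<lambda>xs. F q xs - (flat_dtot (flat_htpy F) q xs + flat_htpy (flat_dtot F) q xs))"
    by (rule ext) (rule flat_proj_eq[OF F])
  moreover have "cochains (flat_htpy F)" "cochains (flat_dtot F)" using flat_htpy_altl[OF F] flat_dtot_altl[OF F] by auto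
  ultimately show ?thesis
    using V.W.altl_diff[OF vsg _ V.W.altl_add[OF vsg flat_dtot_altl flat_htpy_altl]] F by simp
qed

text \<open>The mixed terms cancel: \<open>d\<close> is equivariant, and its sign (-1)^p flips under
  the Chevalley-Eilenberg differential, so the two parts anticommute.\<close>

lemma flat_dtot_flat_dtot:
  assumes F: "cochains F"
  shows "flat_dtot (flat_dtot F) q xs = 0"
proof (cases q)
  case 0
  then show ?thesis using V.ce_ce[OF cochains_mlin[OF F]] by (simp add: flat_dtot_0)
next
  case (Suc r)
  interpret D: lie_mod_pair sg br sv act "Vc r" sv act "Vc (Suc r)" "d r"
    by unfold_locales (simp_all add: d_lin d_in)
  have c: "ce br act (F r) xs \<in> Vc r" by (rule V.ce.cartan_in[OF cochains_mlin[OF F]])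
  have "ce br act (\<lambda>ys. d r (sgnlen (F r) ys)) xs = d r (ce br act (sgnlen (F r)) xs)"
    by (rule D.ce_compose_equivariant[OF d_act altl_mlin[OF cochains_sgnlen[OF F]]])
  also have "\<dots> = - sgnp (length xs) (d r (ce br act (F r) xs))"
    using V.ce_sgnlen[OF cochains_mlin[OF F]] c by (simp add: sgnlen_def d_rules V.W.closed)
  finally have 1: "ce br act (\<lambda>ys. d r (sgnlen (F r) ys)) xs = - sgnp (length xs) (d r (ce br act (F r) xs))" .
  have 2: "d r (sgnlen (flat_dtot F r) xs) = sgnp (length xs) (d r (ce br act (F r) xs))"
  proof (cases r)
    case 0
    then show ?thesis using c by (simp add: flat_dtot_0 sgnlen_def d_rules)
  next
    case (Suc t)
    have "d t (sgnlen (F t) xs) \<in> Vc r" using d_in[OF sgnlen_in[OF F]] Suc by simp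
    moreover have "d r (d t (sgnlen (F t) xs)) = 0" using d_d[OF sgnlen_in[OF F]] Suc by simp
    ultimately show ?thesis
      using c unfolding Suc flat_dtot_Suc sgnlen_add by (simp add: sgnlen_def d_rules V.W.closed)
  qed
  have "ce br act (flat_dtot F (Suc r)) xs = ce br act (ce br act (F (Suc r))) xs + ce br act (\<lambda>ys. d r (sgnlen (F r) ys)) xs"
    unfolding flat_dtot_Suc
    by (rule V.ce.cartan_add[OF V.ce.cartan_mlin[OF cochains_mlin[OF F]] altl_mlin[OF d_sgnlen_altl[OF F]]])
  then show ?thesis
    using V.ce_ce[OF cochains_mlin[OF F]] 1 2 Suc by (simp add: flat_dtot_Suc[of "flat_dtot F"])
qed

lemma flat_dtot_diff:
  assumes F: "cochains F" and G: "cochains G"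
  shows "flat_dtot (\<lambda>q xs. F q xs - G q xs) q xs = flat_dtot F q xs - flat_dtot G q xs"
proof -
  have "ce br act (\<lambda>xs. F q xs - G q xs) xs = ce br act (F q) xs - ce br act (G q) xs"
    by (rule V.ce.cartan_diff[OF cochains_mlin[OF F] cochains_mlin[OF G]])
  moreover have "d r (sgnlen (\<lambda>xs. F r xs - G r xs) xs) = d r (sgnlen (F r) xs) - d r (sgnlen (G r) xs)" for r
    using cochains_in[OF F] cochains_in[OF G] by (simp add: sgnlen_def sgnp_diff d_rules V.W.closed)
  ultimately show ?thesis by (simp add: flat_dtot_def split: nat.split)
qed

text \<open>For P = 1 - (D S + S D) with D D = 0, both P D and D P equal D - D S D.\<close>

lemma flat_proj_flat_dtot:
  assumes F: "cochains F"
  shows "flat_proj (flat_dtot F) q xs = flat_dtot (flat_proj F) q xs"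
proof -
  let ?A = "flat_dtot (flat_htpy F)" and ?B = "flat_htpy (flat_dtot F)"
  have S: "cochains (flat_htpy F)" and D: "cochains (flat_dtot F)" using flat_htpy_altl[OF F] flat_dtot_altl[OF F] by auto
  have A: "cochains ?A" and B: "cochains ?B" using flat_dtot_altl[OF S] flat_htpy_altl[OF D] by auto
  have FA: "cochains (\<lambda>q xs. F q xs - ?A q xs)"
    using V.W.altl_diff[OF vsg] F A by auto
  have "flat_proj F = (\<lambda>q xs. (F q xs - ?A q xs) - ?B q xs)"
    by (intro ext) (simp add: flat_proj_eq[OF F])
  then have "flat_dtot (flat_proj F) q xs = flat_dtot F q xs - flat_dtot ?A q xs - flat_dtot ?B q xs"
    by (simp add: flat_dtot_diff FA B) (simp add: flat_dtot_diff F A)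
  moreover have "flat_htpy (flat_dtot (flat_dtot F)) q xs = 0"
    by (simp add: flat_htpy_def sgnlen_def flat_dtot_flat_dtot[OF F] s_rules)
  ultimately show ?thesis
    by (simp add: flat_proj_eq[OF D] flat_dtot_flat_dtot[OF S])
qed

end

lemma lie_mod_vsubspace: "lie_mod sg br sw act W \<Longrightarrow> vsubspace sw W"
proof -
  assume "lie_mod sg br sw act W"
  then interpret lie_mod sg br sw act W .
  show ?thesis by (rule W.vsubspace_axioms)
qed

section \<open>The chain map and its homotopy on \<Omega>(V)\<close>

context dg_contraction
begin

definition htpy :: "(nat \<Rightarrow> nat \<Rightarrow> 'g list \<Rightarrow> 'v) \<Rightarrow> nat \<Rightarrow> nat \<Rightarrow> 'g list \<Rightarrow> 'v" where
  "htpy c = unflatten (flat_htpy (flatten c))"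

definition proj :: "(nat \<Rightarrow> nat \<Rightarrow> 'g list \<Rightarrow> 'v) \<Rightarrow> nat \<Rightarrow> nat \<Rightarrow> 'g list \<Rightarrow> 'v" where
  "proj c = unflatten (flat_proj (flatten c))"

lemma sgnlen_lwedge_fun: "sgnlen (lwedge sv e f) = lwedge sv (sgnlen e) (sgnlen f)"
  by (rule ext) (rule V.W.sgnlen_lwedge)

lemma htpy_omega: "omega_map sg sv sv Vc Vc (-1) htpy"
  unfolding htpy_def[abs_def]
proof (rule omega_map_flatI[OF vsg V.W.vsubspace_axioms])
  fix F G :: "nat \<Rightarrow> 'g list \<Rightarrow> 'v" and e :: "'g list \<Rightarrow> 'a" and q n xs
  assume "\<And>q. altl sg sv (Vc q) (F q)"
  then have F: "cochains F" by simp
  show "altl sg sv (Vc q) (flat_htpy F q)" by (rule flat_htpy_altl[OF F])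
  show "flat_htpy (\<lambda>q xs. F q xs + G q xs) q xs = flat_htpy F q xs + flat_htpy G q xs" if "\<And>q. altl sg sv (Vc q) (G q)"
  proof -
    have G: "cochains G" using that by simp
    show ?thesis using sgnlen_in[OF F] sgnlen_in[OF G] by (simp add: flat_htpy_def sgnlen_add s_rules)
  qed
  have "lwedge sv (sgnlen e) (\<lambda>ys. s q (sgnlen (F (Suc q)) ys)) xs =
      s q (lwedge sv (sgnlen e) (sgnlen (F (Suc q))) xs)"
    by (rule V.W.lwedge_compose[OF V.W.vector_space_axioms s_lin sgnlen_in[OF F]])
  then show "flat_htpy (\<lambda>q. lwedge sv e (F q)) q xs =
      lwedge sv (if even (- 1 :: int) then e else sgnlen e) (flat_htpy F q) xs"
    by (simp add: flat_htpy_def[abs_def] sgnlen_lwedge_fun)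
  show "flat_htpy F q xs = 0" if "\<And>q xs. int (length xs) + int q \<noteq> n \<Longrightarrow> F q xs = 0"
    "int (length xs) + int q \<noteq> n + - 1"
    using that(1)[of xs "Suc q"] that(2) by (simp add: flat_htpy_def sgnlen_def s_rules)
qed

lemma proj_omega: "omega_map sg sv sv Vc Vc 0 proj"
  unfolding proj_def[abs_def]
proof (rule omega_map_flatI[OF vsg V.W.vsubspace_axioms])
  fix F G :: "nat \<Rightarrow> 'g list \<Rightarrow> 'v" and e :: "'g list \<Rightarrow> 'a" and q n xs
  assume "\<And>q. altl sg sv (Vc q) (F q)"
  then have F: "cochains F" by simp
  have sd_lin: "lin_on sv sv (Vc 0) (\<lambda>v. s 0 (d 0 v))"
    by (simp add: lin_on_def d_rules s_rules d_in V.W.closed)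
  show "altl sg sv (Vc q) (flat_proj F q)" by (rule flat_proj_altl[OF F])
  show "flat_proj (\<lambda>q xs. F q xs + G q xs) q xs = flat_proj F q xs + flat_proj G q xs" if "\<And>q. altl sg sv (Vc q) (G q)"
  proof -
    have G: "cochains G" using that by simp
    have "sgnlen (\<lambda>xs. F (Suc q) xs + G (Suc q) xs) = (\<lambda>xs. sgnlen (F (Suc q)) xs + sgnlen (G (Suc q)) xs)"
      by (rule ext) (rule sgnlen_add)
    then show ?thesis
      using cochains_in[OF F, of 0 xs] cochains_in[OF G, of 0 xs]
      by (simp add: flat_proj_def S.cartan_ptw_add[OF sgnlen_in[OF F] sgnlen_in[OF G]] d_rules s_rules d_in)
  qed
  show "flat_proj (\<lambda>q. lwedge sv e (F q)) q xs = lwedge sv (if even (0 :: int) then e else sgnlen e) (flat_proj F q) xs"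
  proof -
    \<comment> \<open>The Koszul sign of the 1-form cancels against the one of
      \<open>sgnlen\<close>, as befits a map of degree 0.\<close>
    have 1: "cartan (ptw (S.defect q)) (sgnlen (lwedge sv e (F (Suc q)))) xs =
        lwedge sv e (cartan (ptw (S.defect q)) (sgnlen (F (Suc q)))) xs"
      unfolding sgnlen_lwedge_fun S.cartan_ptw_lwedge[OF sgnlen_in[OF F]] sgnlen_sgnlen ..
    have 2: "s 0 (d 0 (lwedge sv e (F 0) xs)) = lwedge sv e (\<lambda>ys. s 0 (d 0 (F 0 ys))) xs"
      by (rule V.W.lwedge_compose[OF V.W.vector_space_axioms sd_lin cochains_in[OF F], symmetric])
    have "lwedge sv e (flat_proj F q) xs = lwedge sv e (\<lambda>ys. if q = 0 then F 0 ys - s 0 (d 0 (F 0 ys)) else 0) xs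
        - lwedge sv e (cartan (ptw (S.defect q)) (sgnlen (F (Suc q)))) xs"
      unfolding flat_proj_def[abs_def] by (rule V.W.lwedge_diff_right)
    with 1 2 show ?thesis
      by (cases "q = 0")
        (simp_all add: flat_proj_def[of "\<lambda>q. lwedge sv e (F q)"] V.W.lwedge_diff_right V.W.lwedge_zero_right)
  qed
  show "flat_proj F q xs = 0" if z: "\<And>q xs. int (length xs) + int q \<noteq> n \<Longrightarrow> F q xs = 0"
    "int (length xs) + int q \<noteq> n + 0"
  proof -
    have "cartan (ptw (S.defect q)) (sgnlen (F (Suc q))) xs = cartan (ptw (S.defect q)) (\<lambda>_. 0) xs"
    proof (rule cartan_cong_length)
      fix ys :: "'g list" assume "Suc (length ys) = length xs"
      then show "sgnlen (F (Suc q)) ys = 0" using z(1)[of ys "Suc q"] z(2) by (simp add: sgnlen_def)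
    qed (simp add: ptw_def)
    also have "\<dots> = 0" by (rule S.cartan_zero)
    finally show ?thesis using z(1)[of xs q] z(2) by (cases "q = 0") (simp_all add: flat_proj_def s_rules d_rules)
  qed
qed

lemma dtot_eq:
  assumes "c \<in> Omega sg sv Vc"
  shows "dtot br act d c = unflatten (flat_dtot (flatten c))"
proof -
  have "sgnp (length xs) (d q (flatten c q xs)) = d q (sgnlen (flatten c q) xs)" for q xs
    using mlin_in[OF altl_mlin[OF Omega_altl[OF assms]]] by (simp add: sgnlen_def d_rules)
  then show ?thesis
    unfolding dtot_def dCE_eq[OF V_lie_mod assms] dW_eq unflatten_add
    by (intro arg_cong[where f = unflatten] ext) (simp add: flat_dtot_def split: nat.split)
qed

lemma Omega_cochains: "c \<in> Omega sg sv Vc \<Longrightarrow> cochains (flatten c)"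
  using Omega_altl by blast

lemma cochains_Omega: "cochains F \<Longrightarrow> unflatten F \<in> Omega sg sv Vc"
  by (intro unflatten_Omega[OF vsg V.W.vsubspace_axioms]) auto

lemma dtot_Omega: "c \<in> Omega sg sv Vc \<Longrightarrow> dtot br act d c \<in> Omega sg sv Vc"
  unfolding dtot_eq using flat_dtot_altl[OF Omega_cochains] by (intro cochains_Omega) auto

lemmas htpy_Omega = omega_mapD(1)[OF htpy_omega]
lemmas proj_Omega = omega_mapD(1)[OF proj_omega]

lemma proj_dtot:
  assumes c: "c \<in> Omega sg sv Vc"
  shows "proj (dtot br act d c) = dtot br act d (proj c)"
  unfolding dtot_eq[OF c] dtot_eq[OF proj_Omega[OF c]]
  unfolding proj_def flatten_unflatten
  by (intro arg_cong[where f = unflatten] ext flat_proj_flat_dtot Omega_cochains c)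

lemma proj_homotopy:
  assumes c: "c \<in> Omega sg sv Vc"
  shows "oadd (proj c) (oadd (dtot br act d (htpy c)) (htpy (dtot br act d c))) = c"
proof -
  have "oadd (proj c) (oadd (dtot br act d (htpy c)) (htpy (dtot br act d c))) =
      unflatten (\<lambda>q xs. flat_proj (flatten c) q xs + (flat_dtot (flat_htpy (flatten c)) q xs + flat_htpy (flat_dtot (flatten c)) q xs))"
    unfolding dtot_eq[OF c] dtot_eq[OF htpy_Omega[OF c]]
    unfolding htpy_def proj_def flatten_unflatten unflatten_add ..
  also have "\<dots> = unflatten (flatten c)"
    by (intro arg_cong[where f = unflatten] ext) (simp add: flat_proj_eq[OF Omega_cochains[OF c]])
  finally show ?thesis using Omega_unflatten_flatten[OF c] by simp
qed

lemma proj_funpow_Omega: "c \<in> Omega sg sv Vc \<Longrightarrow> (proj ^^ k) c \<in> Omega sg sv Vc"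
  by (induction k) (simp_all add: proj_Omega)

lemma proj_funpow_dtot: "c \<in> Omega sg sv Vc \<Longrightarrow> (proj ^^ k) (dtot br act d c) = dtot br act d ((proj ^^ k) c)"
  by (induction k) (simp_all add: proj_dtot proj_funpow_Omega)

lemma proj_funpow_omega:
  "omega_map sg sv su Vc Uc 0 alpha \<Longrightarrow> omega_map sg sv su Vc Uc 0 (\<lambda>c. alpha ((proj ^^ k) c))"
proof (induction k arbitrary: alpha)
  case (Suc k)
  show ?case using Suc.IH[OF omega_map_comp[OF proj_omega Suc.prems]] by simp
qed simp

lemma dg_LP_proj:
  assumes "dg_LP sg br sv act Vc d alpha"
  shows "dg_LP sg br sv act Vc d (\<lambda>c. alpha (proj c))"
proof -
  have "omega_map sg sv sg Vc gcar 0 alpha" using assms by (simp add: dg_LP_def)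
  from omega_map_comp[OF proj_omega this] show ?thesis
    using assms proj_dtot proj_Omega by (simp add: dg_LP_def)
qed

text \<open>Applying \<open>alpha\<close> to 1 - P = D S + S D and moving it past the differential
  exhibits \<open>alpha\<close> after \<open>htpy\<close> as the homotopy.\<close>

lemma homotopic_proj:
  assumes "dg_LP sg br sv act Vc d alpha"
  shows "homotopic sg br sv act Vc d (\<lambda>c. alpha (proj c)) alpha"
proof -
  have om: "omega_map sg sv sg Vc gcar 0 alpha"
    and chain: "\<And>c. c \<in> Omega sg sv Vc \<Longrightarrow> alpha (dtot br act d c) = dCE br br (alpha c)"
    using assms by (auto simp: dg_LP_def)
  note add = omega_mapD(2)[OF om]
  have "osub (alpha c) (alpha (proj c)) = oadd (dCE br br (alpha (htpy c))) (alpha (htpy (dtot br act d c)))"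
    if c: "c \<in> Omega sg sv Vc" for c
  proof -
    let ?A = "dtot br act d (htpy c)" and ?B = "htpy (dtot br act d c)"
    have A: "?A \<in> Omega sg sv Vc" and B: "?B \<in> Omega sg sv Vc"
      using c by (simp_all add: htpy_Omega dtot_Omega)
    have "oadd ?A ?B = unflatten (\<lambda>q xs. flat_dtot (flat_htpy (flatten c)) q xs + flat_htpy (flat_dtot (flatten c)) q xs)"
      unfolding dtot_eq[OF c] dtot_eq[OF htpy_Omega[OF c]]
      unfolding htpy_def flatten_unflatten unflatten_add ..
    also have "\<dots> \<in> Omega sg sv Vc"
    proof (intro cochains_Omega allI V.W.altl_add[OF vsg])
      have F: "cochains (flatten c)" by (rule Omega_cochains[OF c])
      show "altl sg sv (Vc q) (flat_dtot (flat_htpy (flatten c)) q)" "altl sg sv (Vc q) (flat_htpy (flat_dtot (flatten c)) q)" for q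
        using flat_htpy_altl[OF F] flat_dtot_altl[OF F] by (simp_all add: flat_dtot_altl flat_htpy_altl)
    qed
    finally have AB: "oadd ?A ?B \<in> Omega sg sv Vc" .
    have "alpha c = oadd (alpha (proj c)) (oadd (alpha ?A) (alpha ?B))"
      using add[OF proj_Omega[OF c] AB] add[OF A B] proj_homotopy[OF c] by simp
    then show ?thesis
      unfolding chain[OF htpy_Omega[OF c]] by (simp add: osub_def oadd_def)
  qed
  then show ?thesis
    unfolding homotopic_def using omega_map_comp[OF htpy_omega om] by (intro exI[where x = "\<lambda>c. alpha (htpy c)"]) auto
qed

text \<open>\<open>alpha\<close> is generalised because the induction hypothesis is used for
  \<open>alpha\<close> after \<open>proj\<close>, which is again compatible with the differentials
  by \<open>dg_LP_proj\<close>.\<close>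

lemma homotopic_proj_funpow:
  "dg_LP sg br sv act Vc d alpha \<Longrightarrow> homotopic sg br sv act Vc d (\<lambda>c. alpha ((proj ^^ k) c)) alpha"
proof (induction k arbitrary: alpha)
  case 0
  show ?case by (rule homotopic_agree[OF lie]) simp
next
  case (Suc k)
  have "homotopic sg br sv act Vc d (\<lambda>c. alpha (proj ((proj ^^ k) c))) (\<lambda>c. alpha (proj c))"
    by (rule Suc.IH[OF dg_LP_proj[OF Suc.prems]])
  then show ?case
    using homotopic_trans[OF lie _ homotopic_proj[OF Suc.prems]] by simp
qed

text \<open>H^0(V) as a graded submodule of V concentrated in degree 0, so that cochains with values
  in it are again an instance of \<open>Omega\<close>.\<close>

definition ker_car :: "nat \<Rightarrow> 'v set" where
  "ker_car q = (if q = 0 then {v \<in> Vc 0. d 0 v = 0} else {0})"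

lemma ker_car_sub: "ker_car q \<subseteq> Vc q"
  by (auto simp: ker_car_def)

lemma ker_car_lie_mod: "lie_mod sg br sv act (ker_car q)"
proof -
  have "module.subspace sv (ker_car q)"
    by (auto simp: ker_car_def V.W.subspace_def V.W.closed d_rules)
  moreover have "act x 0 = 0" for x by (rule V.act_rules(1))
  moreover have "ker_car q \<subseteq> Vc q" by (rule ker_car_sub)
  moreover have "act x v \<in> ker_car q" if "v \<in> ker_car q" for x v
    using that by (auto simp: ker_car_def V.act_in d_act V.act_rules(1) split: if_splits)
  ultimately have "lie_module_on sg br sv act (ker_car q)"
    using V_mod[of q] by (auto simp: lie_module_on_def lin_on_def subset_iff)
  then show ?thesis by unfold_locales
qed

section \<open>Powers of the chain map end in \<Omega>(ker d_0)\<close>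

lemma flatten_proj_funpow: "flatten ((proj ^^ k) c) = (flat_proj ^^ k) (flatten c)"
  by (induction k) (simp_all add: proj_def)

lemma flat_proj_funpow_cochains: "cochains F \<Longrightarrow> cochains ((flat_proj ^^ k) F)"
  by (induction k) (simp_all add: flat_proj_altl)

text \<open>In positive degree q the new component is computed from the component q + 1 alone, so
  the vanishing above N descends by one degree with each application.\<close>

lemma flat_proj_funpow_vanish:
  assumes "\<And>q. q > N \<Longrightarrow> Vc q = {0}" "cochains F"
  shows "0 < q \<Longrightarrow> N < q + k \<Longrightarrow> (flat_proj ^^ k) F q = (\<lambda>_. 0)"
proof (induction k arbitrary: q)
  case 0
  then show ?case using assms(1)[of q] cochains_in[OF assms(2), of q] by auto
next
  case (Suc k)
  then have "sgnlen ((flat_proj ^^ k) F (Suc q)) = (\<lambda>_. 0)"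
    by (simp add: sgnlen_def)
  with Suc.prems(1) show ?case
    by (intro ext) (simp add: flat_proj_def[of "(flat_proj ^^ k) F"] S.cartan_zero)
qed

text \<open>N applications remove all positive degrees. In the last one the 1-form term therefore
  vanishes and 1 - s d acts in degree 0, with values in ker d_0; this accounts for the exponent
  \<open>Suc N\<close>.\<close>

lemma proj_funpow_kernel:
  assumes N: "\<And>q. q > N \<Longrightarrow> Vc q = {0}" and c: "c \<in> Omega sg sv Vc"
  shows "(proj ^^ Suc N) c \<in> Omega sg sv ker_car"
proof -
  let ?F = "(flat_proj ^^ Suc N) (flatten c)" and ?G = "(flat_proj ^^ N) (flatten c)"
  note F = Omega_cochains[OF c]
  have "?F q xs \<in> ker_car q" for q xs
  proof (cases "q = 0")
    case True
    have "sgnlen (?G (Suc 0)) = (\<lambda>_. 0)"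
      using flat_proj_funpow_vanish[where q = "Suc 0" and k = N, OF N F] by (simp add: sgnlen_def)
    then have e: "?F 0 xs = ?G 0 xs - s 0 (d 0 (?G 0 xs))"
      by (simp add: flat_proj_def[of ?G] S.cartan_zero)
    have v: "?G 0 xs \<in> Vc 0" by (rule cochains_in[OF flat_proj_funpow_cochains[OF F]])
    have "d 0 (s 0 (d 0 (?G 0 xs))) = d 0 (?G 0 xs)"
      using s_homotopy[OF d_in[OF v]] d_d[OF v] by (simp add: s_rules)
    then show ?thesis
      using True v e by (simp add: ker_car_def d_rules s_in d_in V.W.closed)
  next
    case False
    then show ?thesis using flat_proj_funpow_vanish[where q = q and k = "Suc N", OF N F] by (simp add: ker_car_def del: funpow.simps)
  qed
  moreover have "altl sg sv (Vc q) (?F q)" for q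
    using flat_proj_funpow_cochains[OF F] by blast
  ultimately have "altl sg sv (ker_car q) (?F q)" for q
    by (simp add: altl_def mlin_def del: funpow.simps)
  then have "unflatten ?F \<in> Omega sg sv ker_car"
    by (intro unflatten_Omega vsg lie_mod_vsubspace[OF ker_car_lie_mod])
  then show ?thesis
    using Omega_unflatten_flatten[OF proj_funpow_Omega[OF c], of "Suc N"] by (simp only: flatten_proj_funpow)
qed

lemma flatten_emb0: "flatten (emb0 v) q xs = (if q = 0 \<and> xs = [] then v else 0)"
  by (simp add: flatten_def emb0_def)

text \<open>Ensures that precomposition with powers of \<open>proj\<close> leaves the map induced on
  H^0 unchanged.\<close>

lemma proj_emb0:
  assumes "v \<in> ker_car 0"
  shows "proj (emb0 v) = emb0 v"
proof -
  have y: "sgnlen (flatten (emb0 v) (Suc q)) = (\<lambda>_. 0)" for q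
    by (simp add: sgnlen_def flatten_emb0)
  have z: "cartan (ptw (S.defect q)) (sgnlen (flatten (emb0 v) (Suc q))) xs = 0" for q xs
    unfolding y by (rule S.cartan_zero)
  have "flat_proj (flatten (emb0 v)) q xs = flatten (emb0 v) q xs" for q xs
    unfolding flat_proj_def z using assms by (auto simp: flatten_emb0 ker_car_def d_rules s_rules)
  then have "proj (emb0 v) = unflatten (flatten (emb0 v))"
    unfolding proj_def by (intro arg_cong[where f = unflatten] ext)
  also have "\<dots> = emb0 v"
    by (intro ext) (simp add: unflatten_def flatten_def emb0_def)
  finally show ?thesis .
qed

lemma proj_funpow_emb0: "v \<in> ker_car 0 \<Longrightarrow> (proj ^^ k) (emb0 v) = emb0 v"
  by (induction k) (simp_all add: proj_emb0)

end

section \<open>Generation in degree zero\<close>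

lemma oadd_Omega:
  assumes "vector_space sg" "\<And>q. vsubspace su (Uc q)" "c \<in> Omega sg su Uc" "c' \<in> Omega sg su Uc"
  shows "oadd c c' \<in> Omega sg su Uc"
proof -
  have "oadd c c' = unflatten (\<lambda>q xs. flatten c q xs + flatten c' q xs)"
    using Omega_unflatten_flatten[OF assms(3)] Omega_unflatten_flatten[OF assms(4)]
    by (metis unflatten_add)
  also have "\<dots> \<in> Omega sg su Uc"
    by (intro unflatten_Omega assms(1,2) vsubspace.altl_add Omega_altl assms(3,4))
  finally show ?thesis .
qed

lemma omega_map_sum:
  assumes vs: "vector_space sg" "\<And>q. vsubspace sw (Wc q)"
    and om: "omega_map sg sw su Wc Uc k F" and "finite B" and "\<And>b. b \<in> B \<Longrightarrow> g b \<in> Omega sg sw Wc"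
  shows "(\<lambda>p q xs. \<Sum>b\<in>B. g b p q xs) \<in> Omega sg sw Wc \<and>
    F (\<lambda>p q xs. \<Sum>b\<in>B. g b p q xs) = (\<lambda>p q xs. \<Sum>b\<in>B. F (g b) p q xs)"
  using assms(4,5)
proof (induction B)
  case empty
  have "unflatten (\<lambda>_ _. 0) \<in> Omega sg sw Wc"
    by (intro unflatten_Omega vs vsubspace.altl_zero)
  then have z: "(\<lambda>_ _ _. 0) \<in> Omega sg sw Wc"
    by (simp add: unflatten_def[abs_def])
  have "F (\<lambda>_ _ _. 0) = oadd (F (\<lambda>_ _ _. 0)) (F (\<lambda>_ _ _. 0))"
    using omega_mapD(2)[OF om z z] by (simp add: oadd_def)
  then have "F (\<lambda>_ _ _. 0) p q xs = 0" for p q xs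
    by (metis add_cancel_right_right oadd_def)
  with z show ?case by auto
next
  case (insert b B)
  have "(\<lambda>p q xs. \<Sum>b\<in>insert b B. g b p q xs) = oadd (g b) (\<lambda>p q xs. \<Sum>b\<in>B. g b p q xs)"
    using insert.hyps by (simp add: oadd_def)
  moreover have "(\<lambda>p q xs. \<Sum>b\<in>insert b B. F (g b) p q xs) = oadd (F (g b)) (\<lambda>p q xs. \<Sum>b\<in>B. F (g b) p q xs)"
    using insert.hyps by (simp add: oadd_def)
  ultimately show ?case
    using insert oadd_Omega[OF vs] omega_mapD(2)[OF om] by auto
qed

lemma altl_mono: "altl sg sw K f \<Longrightarrow> K \<subseteq> W \<Longrightarrow> altl sg sw W f"
  by (rule altlI, rule mlinI) (auto simp: mlin_lin[OF altl_mlin] altl_adj intro: mlin_in[OF altl_mlin])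

lemma Omega_mono:
  assumes "vector_space sg" "\<And>q. vsubspace sw (Wc q)" "\<And>q. ker_car q \<subseteq> Wc q" "c \<in> Omega sg sw ker_car"
  shows "c \<in> Omega sg sw Wc"
proof -
  have "unflatten (flatten c) \<in> Omega sg sw Wc"
    by (rule unflatten_Omega[OF assms(1,2)]) (rule altl_mono[OF Omega_altl[OF assms(4)] assms(3)])
  then show ?thesis by (simp add: Omega_unflatten_flatten[OF assms(4)])
qed

lemma emb0_Omega:
  assumes vs: "vector_space sg" "\<And>q. vsubspace sw (Wc q)" and v: "v \<in> Wc 0"
  shows "emb0 v \<in> Omega sg sw Wc"
proof -
  interpret W: vsubspace sw "Wc q" for q by (rule vs)
  have eq: "emb0 v = unflatten (\<lambda>q xs. if q = 0 \<and> xs = [] then v else 0)"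
    by (intro ext) (auto simp: emb0_def unflatten_def)
  have "altl sg sw (Wc q) (\<lambda>xs. if q = 0 \<and> xs = [] then v else 0)" for q
    by (rule altlI, rule mlinI) (use v in auto)
  then show ?thesis unfolding eq by (rule unflatten_Omega[OF vs])
qed

text \<open>By Euler's identity every cochain with values in \<open>ker_car\<close> is its component
  of form degree 0 plus a sum of wedge products of dual basis forms with cochains one degree lower,
  so values on \<open>ker_car 0\<close> propagate to all form degrees.\<close>

lemma omega_maps_agree:
  fixes sg :: "'a::field_char_0 \<Rightarrow> 'g::ab_group_add \<Rightarrow> 'g"
    and sw :: "'a \<Rightarrow> 'w::ab_group_add \<Rightarrow> 'w" and su :: "'a \<Rightarrow> 'u::ab_group_add \<Rightarrow> 'u"
  assumes fd: "finite_dimensional_vector_space sg B" and su: "vector_space su"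
    and Wc: "\<And>q. vsubspace sw (Wc q)" and ker_car: "\<And>q. vsubspace sw (ker_car q)"
    and sub: "\<And>q. ker_car q \<subseteq> Wc q" and ker_zero: "\<And>q. q > 0 \<Longrightarrow> ker_car q = {0}"
    and om: "omega_map sg sw su Wc Uc 0 alpha" and om': "omega_map sg sw su Wc Uc 0 alpha'"
    and emb: "\<And>v. v \<in> ker_car 0 \<Longrightarrow> alpha (emb0 v) = alpha' (emb0 v)"
    and c: "c \<in> Omega sg sw ker_car"
  shows "alpha c = alpha' c"
proof -
  interpret fd: finite_dimensional_vector_space sg B by (rule fd)
  interpret K: vsubspace sw "ker_car q" for q by (rule ker_car)
  note vsg = fd.vector_space_axioms
  have mono: "c \<in> Omega sg sw ker_car \<Longrightarrow> c \<in> Omega sg sw Wc" for c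
    by (rule Omega_mono[where ker_car = ker_car, OF vsg Wc sub])
  define e where "e b x = fd.representation B x b" for b x
  have fin: "finite B" by (rule fd.finite_Basis)
  have e_lin: "lin_on sg (*) UNIV (e b)" for b
    unfolding lin_on_def e_def
    by (simp add: fd.representation_add fd.representation_scale fd.independent_Basis fd.span_Basis)
  have e_exp: "(\<Sum>b\<in>B. sg (e b x) b) = x" for x
    unfolding e_def
    by (rule fd.sum_representation_eq) (simp_all add: fd.independent_Basis fd.span_Basis fin)
  define eta where "eta b r xs = (if r = 1 \<and> length xs = 1 then e b (hd xs) else 0)" for b and r :: nat and xs :: "'g list"
  have eta_K: "eta b \<in> OmegaK sg" for b
  proof -
    have "alt_map sg (*) UNIV r (eta b r)" for r
      using e_lin[of b] by (auto simp: alt_map_def eta_def lin_on_def length_Suc_conv)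
    then show ?thesis by (simp add: OmegaK_def)
  qed
  have flat_eta: "flatK (eta b) = (\<lambda>ys. if length ys = 1 then e b (hd ys) else 0)" for b
    by (rule ext) (simp add: flatK_def eta_def)
  \<comment> \<open>This is i_b of c divided by its form degree. After contraction \<open>zs\<close>
    is never empty, so the division is by a positive integer, invertible in characteristic
    zero.\<close>
  define cb where "cb c b = unflatten (\<lambda>q. contract b (\<lambda>zs. sw (inverse (of_nat (length zs))) (flatten c q zs)))"
    for c :: "nat \<Rightarrow> nat \<Rightarrow> 'g list \<Rightarrow> 'w" and b
  have cb_K: "cb c b \<in> Omega sg sw ker_car" if "c \<in> Omega sg sw ker_car" for c b
    unfolding cb_def
    by (intro unflatten_Omega vsg ker_car altl_contract K.altl_scale_length Omega_altl that)
  have wcb: "wedge sw (eta b) (cb c b) = unflatten (\<lambda>q. cartan (ptw (\<lambda>x. sw (e b x)))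
      (contract b (\<lambda>zs. sw (inverse (of_nat (length zs))) (flatten c q zs))))" for c b
    unfolding wedge_eq flat_eta cb_def flatten_unflatten
    by (intro arg_cong[where f = unflatten] ext lwedge_one_form K.vector_space_axioms)
  have wcb_K: "wedge sw (eta b) (cb c b) \<in> Omega sg sw ker_car" if c: "c \<in> Omega sg sw ker_car" for c b
    unfolding wcb
  proof (intro unflatten_Omega vsg ker_car)
    fix q
    interpret op_form sg sw "ker_car q" sw "ker_car q" "\<lambda>x. sw (e b x)"
      by (rule K.scalar_form[OF vsg e_lin])
    show "altl sg sw (ker_car q) (cartan (ptw (\<lambda>x. sw (e b x)))
        (contract b (\<lambda>zs. sw (inverse (of_nat (length zs))) (flatten c q zs))))"
      by (intro cartan_altl altl_contract K.altl_scale_length Omega_altl c)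
  qed
  have decomp: "c = oadd (emb0 (c 0 0 [])) (\<lambda>p q xs. \<Sum>b\<in>B. wedge sw (eta b) (cb c b) p q xs)"
    if c: "c \<in> Omega sg sw ker_car" for c
  proof (intro ext)
    fix p q and xs :: "'g list"
    have euler: "(\<Sum>b\<in>B. cartan (ptw (\<lambda>x. sw (e b x)))
          (contract b (\<lambda>zs. sw (inverse (of_nat (length zs))) (flatten c q zs))) xs) =
        sw (of_nat (length xs)) (sw (inverse (of_nat (length xs))) (flatten c q xs))"
      by (rule K.euler_identity[OF vsg fin e_lin e_exp K.altl_scale_length[OF Omega_altl[OF c]]])
    show "c p q xs = oadd (emb0 (c 0 0 [])) (\<lambda>p q xs. \<Sum>b\<in>B. wedge sw (eta b) (cb c b) p q xs) p q xs"
    proof (cases "length xs = p")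
      case True
      \<comment> \<open>At the empty list the sum over the basis is 0 and \<open>emb0\<close> has to
        supply the value. It does so for q = 0; the other components vanish because
        \<open>ker_car\<close> is zero there.\<close>
      have "c 0 q [] = 0" if "q \<noteq> 0"
        using mlin_in[OF altl_mlin[OF Omega_altl[OF c, of q]], of "[]"] ker_zero[of q] that
        by (simp add: flatten_def)
      then show ?thesis
        using True euler by (cases xs) (auto simp: oadd_def emb0_def wcb unflatten_def flatten_def)
    next
      case False
      then have "c p q xs = 0" using c by (simp add: Omega_def alt_map_def)
      with False show ?thesis by (auto simp: oadd_def emb0_def wcb unflatten_def)
    qed
  qed
  have expand: "beta c = oadd (beta (emb0 (c 0 0 []))) (\<lambda>p q xs. \<Sum>b\<in>B. wedge su (eta b) (beta (cb c b)) p q xs)"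
    if c: "c \<in> Omega sg sw ker_car" and beta: "omega_map sg sw su Wc Uc 0 beta" for beta c
  proof -
    have v: "c 0 0 [] \<in> ker_car 0"
      using mlin_in[OF altl_mlin[OF Omega_altl[OF c, of 0]], of "[]"] by (simp add: flatten_def)
    have W: "cb c b \<in> Omega sg sw Wc" "wedge sw (eta b) (cb c b) \<in> Omega sg sw Wc" for b
      using cb_K[OF c] wcb_K[OF c] mono by blast+
    note sums = omega_map_sum[where g = "\<lambda>b. wedge sw (eta b) (cb c b)", OF vsg Wc beta fin W(2)]
    have "beta c = oadd (beta (emb0 (c 0 0 []))) (beta (\<lambda>p q xs. \<Sum>b\<in>B. wedge sw (eta b) (cb c b) p q xs))"
      using omega_mapD(2)[OF beta emb0_Omega[where Wc = Wc, OF vsg Wc subsetD[OF sub v]] conjunct1[OF sums]] decomp[OF c] by simp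
    then show ?thesis
      using conjunct2[OF sums] omega_mapD(3)[OF beta W(1) eta_K] by simp
  qed
  \<comment> \<open>The induction is on the length of the list at which the images are evaluated,
    since \<open>c\<close> itself is inhomogeneous. Wedging with a 1-form raises the form degree by
    one, so \<open>expand\<close> leads only to shorter lists.\<close>
  have "flatten (alpha c) q xs = flatten (alpha' c) q xs" if "c \<in> Omega sg sw ker_car" "length xs = n" for c q xs n
    using that
  proof (induction n arbitrary: c xs rule: less_induct)
    case (less n)
    have v: "c 0 0 [] \<in> ker_car 0"
      using mlin_in[OF altl_mlin[OF Omega_altl[OF less.prems(1), of 0]], of "[]"] by (simp add: flatten_def)
    have w: "wedge su (eta b) a p q xs = cartan (ptw (\<lambda>x. su (e b x))) (flatten a q) xs" if "length xs = p" for a b p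
      unfolding wedge_eq flat_eta unflatten_def lwedge_one_form[OF su] using that by simp
    have "cartan (ptw (\<lambda>x. su (e b x))) (flatten (alpha (cb c b)) q) xs =
        cartan (ptw (\<lambda>x. su (e b x))) (flatten (alpha' (cb c b)) q) xs" for b
      by (rule cartan_cong_length) (use less.IH[OF _ cb_K[OF less.prems(1)]] less.prems(2) in \<open>auto simp: ptw_def\<close>)
    then show ?case
      unfolding flatten_def[of "alpha c"] flatten_def[of "alpha' c"]
      unfolding expand[OF less.prems(1) om] expand[OF less.prems(1) om'] oadd_def emb[OF v]
      by (simp add: w)
  qed
  then have "flatten (alpha c) = flatten (alpha' c)" using c by (intro ext) auto
  moreover have "c \<in> Omega sg sw Wc" using mono[OF c] .
  ultimately show ?thesis
    using Omega_unflatten_flatten[OF omega_mapD(1)[OF om]] Omega_unflatten_flatten[OF omega_mapD(1)[OF om']]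
    by metis
qed

section \<open>Existence and uniqueness of the lift\<close>

lemma lin_on_extend:
  assumes "vsubspace s1 W" "vector_space s2" "lin_on s1 s2 W f"
  shows "\<exists>g. Vector_Spaces.linear s1 s2 g \<and> (\<forall>x\<in>W. g x = f x)"
proof -
  interpret W: vsubspace s1 W by fact
  interpret s2: vector_space s2 by fact
  interpret vector_space_pair s1 s2 by unfold_locales
  obtain B where B: "B \<subseteq> W" "W.independent B" "W \<subseteq> W.span B"
    using W.maximal_independent_subset by metis
  obtain g where g: "Vector_Spaces.linear s1 s2 g" "\<And>x. x \<in> B \<Longrightarrow> g x = f x"
    using linear_independent_extend[OF B(2)] by metis
  note r = lin_on_rules[OF assms(3,1,2)]
  have "x \<in> W \<and> g x = f x" if "x \<in> W.span B" for x
    using that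
  proof (induction rule: W.span_induct_alt)
    case base
    then show ?case using linear_0[OF g(1)] r(1) by simp
  next
    case (step c x y)
    then have "x \<in> W" using B(1) by blast
    with step show ?case
      using linear_add[OF g(1)] linear_scale[OF g(1)] g(2) by (simp add: r W.closed)
  qed
  with g(1) B(3) show ?thesis by blast
qed

text \<open>\<open>f\<close> is linear on \<open>W\<close> only, so it is first extended to the
  whole space, where a right inverse with range in \<open>W\<close> is available.\<close>

lemma lin_on_right_inverse:
  assumes "vsubspace s1 W" "vector_space s2" "lin_on s1 s2 W f"
  shows "\<exists>r. lin_on s2 s1 UNIV r \<and> range r \<subseteq> W \<and> (\<forall>z\<in>f ` W. f (r z) = z)"
proof -
  interpret W: vsubspace s1 W by fact
  interpret s2: vector_space s2 by fact
  interpret vector_space_pair s1 s2 by unfold_locales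
  interpret p: vector_space_pair s2 s1 by unfold_locales
  obtain g where g: "Vector_Spaces.linear s1 s2 g" "\<And>x. x \<in> W \<Longrightarrow> g x = f x"
    using lin_on_extend[OF assms] by blast
  obtain r where r: "range r \<subseteq> W" "Vector_Spaces.linear s2 s1 r" "\<forall>v\<in>g ` W. g (r v) = v"
    using linear_exists_right_inverse_on[OF g(1) W.subspace] by blast
  have "lin_on s2 s1 UNIV r"
    by (simp add: lin_on_def p.linear_add[OF r(2)] p.linear_scale[OF r(2)])
  moreover have "f (r z) = z" if "z \<in> f ` W" for z
    using that r(1,3) g(2) by (metis image_cong rangeI subsetD)
  ultimately show ?thesis using r(1) by blast
qed

section \<open>The linear contraction of a resolution\<close>

lemma dg_contraction_exists:
  assumes lie: "lie_algebra sg br" and dg: "dg_module sg br sv act Vc d"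
    and exact: "\<And>q. {v \<in> Vc (Suc q). d (Suc q) v = 0} = d q ` Vc q"
  shows "\<exists>s. dg_contraction sg br sv act Vc d s"
proof -
  have lm: "lie_mod sg br sv act (Vc q)" for q
    using lie dg by unfold_locales (auto simp: dg_module_def)
  interpret V: lie_mod sg br sv act "Vc q" for q by (rule lm)
  have d_lin: "lin_on sv sv (Vc q) (d q)" and d_in: "v \<in> Vc q \<Longrightarrow> d q v \<in> Vc (Suc q)"
    and d_d: "v \<in> Vc q \<Longrightarrow> d (Suc q) (d q v) = 0" for q v
    using dg by (auto simp: dg_module_def)
  note d_rules = lin_on_rules[OF d_lin V.W.vsubspace_axioms V.W.vector_space_axioms]
  have "\<forall>q. \<exists>r. lin_on sv sv UNIV r \<and> range r \<subseteq> Vc q \<and> (\<forall>z\<in>d q ` Vc q. d q (r z) = z)"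
    using lin_on_right_inverse[OF V.W.vsubspace_axioms V.W.vector_space_axioms d_lin] by blast
  then obtain r where r_lin: "\<And>q. lin_on sv sv UNIV (r q)" and r_range: "\<And>q. range (r q) \<subseteq> Vc q"
    and r_inv: "\<And>q z. z \<in> d q ` Vc q \<Longrightarrow> d q (r q z) = z"
    by metis
  note r_rules = lin_on_rules[OF r_lin vsubspace_UNIV[OF V.W.vector_space_axioms] V.W.vector_space_axioms]
  have r_in: "r q v \<in> Vc q" for q v using r_range by blast
  \<comment> \<open>Subtracting r d v turns v into a cocycle; by exactness it is a coboundary, and
    there \<open>r q\<close> is a right inverse of \<open>d q\<close>. On coboundaries the
    correction vanishes, so s d v = r d v, exactly the term subtracted.\<close>
  define s where "s q v = r q (v - r (Suc q) (d (Suc q) v))" for q v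
  have "dg_contraction sg br sv act Vc d s"
  proof unfold_locales
    show "dg_module sg br sv act Vc d" by fact
    show "lin_on sv sv (Vc (Suc q)) (s q)" for q
      unfolding lin_on_def s_def
      by (simp add: r_rules d_rules V.W.closed V.W.scale_right_diff_distrib)
    fix q v
    assume v: "v \<in> Vc (Suc q)"
    show "s q v \<in> Vc q" by (simp add: s_def r_in)
    have dv: "d (Suc q) v \<in> d (Suc q) ` Vc (Suc q)" using v by blast
    have "d (Suc q) (v - r (Suc q) (d (Suc q) v)) = 0"
      using v r_inv[OF dv] r_in by (simp add: d_rules)
    then have "v - r (Suc q) (d (Suc q) v) \<in> d q ` Vc q"
      using exact[of q] v r_in V.W.in_diff by blast
    then have "d q (s q v) = v - r (Suc q) (d (Suc q) v)"
      unfolding s_def by (rule r_inv)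
    moreover have "s (Suc q) (d (Suc q) v) = r (Suc q) (d (Suc q) v)"
      using d_d[OF v] by (simp add: s_def r_rules)
    ultimately show "d q (s q v) + s (Suc q) (d (Suc q) v) = v" by simp
  qed
  then show ?thesis by blast
qed

section \<open>The lift of an equivariant map on ker d_0\<close>

context dg_contraction
begin

lemma dg_lift_exists:
  assumes N: "\<And>q. q > N \<Longrightarrow> Vc q = {0}"
    and Y_lin: "lin_on sv sg (ker_car 0) Y" and Y_act: "\<And>x v. v \<in> ker_car 0 \<Longrightarrow> Y (act x v) = br x (Y v)"
  shows "\<exists>alpha. dg_LP sg br sv act Vc d alpha \<and> (\<forall>v\<in>ker_car 0. alpha0 alpha v = Y v)"
proof -
  interpret g: lie_mod sg br sg br "gcar q" for q by (rule gcar_lie_mod[OF lie])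
  interpret K: lie_mod sg br sv act "ker_car q" for q by (rule ker_car_lie_mod)
  note Y_rules = lin_on_rules[OF Y_lin K.W.vsubspace_axioms vsg]
  \<comment> \<open>\<open>Y\<close> is only controlled on ker d_0. The projection 1 - s d extends
    it linearly to V^0, which yields an \<Omega>-linear map on all of \<Omega>(V). The extension is
    in general not equivariant, so the chain map property has to wait for the power of
    \<open>proj\<close>.\<close>
  define Y' where "Y' v = Y (v - s 0 (d 0 v))" for v
  have pi_in: "v - s 0 (d 0 v) \<in> ker_car 0" if v: "v \<in> Vc 0" for v
  proof -
    have "d 0 (s 0 (d 0 v)) = d 0 v"
      using s_homotopy[OF d_in[OF v]] d_d[OF v] by (simp add: s_rules)
    then show ?thesis using v by (simp add: ker_car_def d_rules s_in d_in V.W.closed)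
  qed
  have Y'_eq: "Y' v = Y v" if "v \<in> ker_car 0" for v
    using that by (simp add: Y'_def ker_car_def s_rules)
  have Y'_lin: "lin_on sv sg (Vc 0) Y'"
    unfolding lin_on_def
  proof (intro ballI allI)
    fix x y a assume xy: "x \<in> Vc 0" "y \<in> Vc 0"
    have eq: "sv a x + y - s 0 (d 0 (sv a x + y)) = sv a (x - s 0 (d 0 x)) + (y - s 0 (d 0 y))"
      using xy by (simp add: d_rules s_rules d_in V.W.closed V.W.scale_right_diff_distrib)
    show "Y' (sv a x + y) = sg a (Y' x) + Y' y"
      unfolding Y'_def eq using pi_in[OF xy(1)] pi_in[OF xy(2)] by (simp add: Y_rules K.W.closed)
  qed
  note Y'_rules = lin_on_rules[OF Y'_lin V.W.vsubspace_axioms vsg]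
  define YF where "YF F q xs = (if q = 0 then Y' (F 0 xs) else 0)"
    for F :: "nat \<Rightarrow> 'g list \<Rightarrow> 'v" and q :: nat and xs
  have Ym: "omega_map sg sv sg Vc gcar 0 (\<lambda>c. unflatten (YF (flatten c)))"
  proof (rule omega_map_flatI[OF vsg g.W.vsubspace_axioms])
    fix F G :: "nat \<Rightarrow> 'g list \<Rightarrow> 'v" and e :: "'g list \<Rightarrow> 'a" and q :: nat and n xs
    assume F: "\<And>q. altl sg sv (Vc q) (F q)"
    show "altl sg sg (gcar q) (YF F q)"
    proof (cases "q = 0")
      case True
      then have "YF F q = (\<lambda>xs. Y' (F 0 xs))" by (simp add: YF_def[abs_def])
      moreover have "altl sg sg (gcar 0) (\<lambda>xs. Y' (F 0 xs))"
        by (rule V.W.altl_compose[OF g.W.vsubspace_axioms Y'_lin _ F]) (simp add: gcar_def)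
      ultimately show ?thesis using True by simp
    next
      case False
      then have "YF F q = (\<lambda>_. 0)" by (simp add: YF_def[abs_def])
      then show ?thesis using g.W.altl_zero[OF vsg] by simp
    qed
    note F_in = mlin_in[OF altl_mlin[OF F]]
    show "YF (\<lambda>q xs. F q xs + G q xs) q xs = YF F q xs + YF G q xs" if G: "\<And>q. altl sg sv (Vc q) (G q)"
      using F_in mlin_in[OF altl_mlin[OF G]] by (simp add: YF_def Y'_rules)
    have "lwedge sg e (\<lambda>ys. Y' (F 0 ys)) xs = Y' (lwedge sv e (F 0) xs)"
      by (rule V.W.lwedge_compose[OF vsg Y'_lin F_in])
    then show "YF (\<lambda>q. lwedge sv e (F q)) q xs = lwedge sg (if even (0::int) then e else sgnlen e) (YF F q) xs"
      by (cases "q = 0") (simp_all add: YF_def[abs_def] g.W.lwedge_zero_right)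
    show "YF F q xs = 0" if "\<And>q xs. int (length xs) + int q \<noteq> n \<Longrightarrow> F q xs = 0"
      "int (length xs) + int q \<noteq> n + 0"
      using that(1)[of xs q] that(2) by (cases "q = 0") (simp_all add: YF_def Y'_rules)
  qed
  define alpha where "alpha c = unflatten (YF (flatten ((proj ^^ Suc N) c)))" for c
  have om: "omega_map sg sv sg Vc gcar 0 alpha"
    unfolding alpha_def[abs_def] by (rule proj_funpow_omega[OF Ym])
  have "alpha (dtot br act d c) = dCE br br (alpha c)" if c: "c \<in> Omega sg sv Vc" for c
  proof -
    let ?c = "(proj ^^ Suc N) c"
    have k: "?c \<in> Omega sg sv ker_car" by (rule proj_funpow_kernel[OF N c])
    have v: "?c \<in> Omega sg sv Vc" by (rule proj_funpow_Omega[OF c])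
    have a: "unflatten (YF (flatten ?c)) \<in> Omega sg sg gcar" by (rule omega_mapD(1)[OF Ym v])
    interpret Y: lie_mod_pair sg br sv act "ker_car 0" sg br "gcar 0" Y'
      using Y_lin by unfold_locales (auto simp: lin_on_def gcar_def Y'_eq K.W.closed)
    \<comment> \<open>The values of \<open>?c\<close> lie in ker d_0, where \<open>Y'\<close> agrees
      with the equivariant \<open>Y\<close>. In degree 0, the only one that \<open>YF\<close> reads,
      the total differential is the Chevalley-Eilenberg one.\<close>
    have "YF (flat_dtot (flatten ?c)) q xs = ce br br (YF (flatten ?c) q) xs" for q xs
    proof (cases "q = 0")
      case True
      have "ce br br (\<lambda>xs. Y' (flatten ?c 0 xs)) xs = Y' (ce br act (flatten ?c 0) xs)"
        by (rule Y.ce_compose_equivariant[OF _ altl_mlin[OF Omega_altl[OF k]]])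
          (simp add: Y'_eq Y_act K.act_in)
      then show ?thesis using True by (simp add: YF_def[abs_def] flat_dtot_0)
    next
      case False
      then show ?thesis by (simp add: YF_def[abs_def] g.ce.cartan_zero)
    qed
    then have "unflatten (YF (flat_dtot (flatten ?c))) = dCE br br (unflatten (YF (flatten ?c)))"
      unfolding dCE_eq[OF gcar_lie_mod[OF lie] a] flatten_unflatten
      by (intro arg_cong[where f = unflatten] ext)
    then show ?thesis
      unfolding alpha_def proj_funpow_dtot[OF c] dtot_eq[OF v] flatten_unflatten .
  qed
  moreover have "alpha0 alpha v = Y v" if "v \<in> ker_car 0" for v
    unfolding alpha0_def alpha_def proj_funpow_emb0[OF that]
    using that by (simp add: unflatten_def YF_def flatten_emb0 Y'_eq)
  ultimately show ?thesis
    using om dg by (auto simp: dg_LP_def)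
qed

end

theorem theorem1p20:
  fixes sg :: "'a::field_char_0 \<Rightarrow> 'g::ab_group_add \<Rightarrow> 'g"
    and br :: "'g \<Rightarrow> 'g \<Rightarrow> 'g"
    and sm :: "'a \<Rightarrow> 'm::ab_group_add \<Rightarrow> 'm"
    and actm :: "'g \<Rightarrow> 'm \<Rightarrow> 'm"
    and sv :: "'a \<Rightarrow> 'v::ab_group_add \<Rightarrow> 'v"
    and act :: "'g \<Rightarrow> 'v \<Rightarrow> 'v"
    and Vc :: "nat \<Rightarrow> 'v set"
    and d :: "nat \<Rightarrow> 'v \<Rightarrow> 'v"
    and iota :: "'m \<Rightarrow> 'v"
    and X :: "'m \<Rightarrow> 'g"
  assumes "fd_lie_algebra sg br"
    and "lie_module_on sg br sm actm UNIV"
    and "resolution sg br sv act Vc d sm actm iota"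
    and "LP_module sg br sm actm X"
  shows "(\<exists>alpha. dg_lift sg br sv act Vc d iota X alpha)
       \<and> (\<forall>alpha alpha'. dg_lift sg br sv act Vc d iota X alpha
            \<and> dg_lift sg br sv act Vc d iota X alpha'
            \<longrightarrow> homotopic sg br sv act Vc d alpha alpha')"
proof -
  obtain B where lie: "lie_algebra sg br" and B: "finite_dimensional_vector_space sg B"
    using assms(1) by (auto simp: fd_lie_algebra_def)
  have dg: "dg_module sg br sv act Vc d" and iota_lin: "lin_on sm sv UNIV iota" and inj: "inj iota"
    and iota_act: "\<And>x m. iota (actm x m) = act x (iota m)"
    and range_iota: "range iota = {v \<in> Vc 0. d 0 v = 0}"
    and exact: "\<And>q. {v \<in> Vc (Suc q). d (Suc q) v = 0} = d q ` Vc q"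
    using assms(3) by (auto simp: resolution_def)
  have X_lin: "lin_on sm sg UNIV X" and X_act: "\<And>x m. X (actm x m) = br x (X m)"
    using assms(4) by (auto simp: LP_module_def)
  obtain N where N: "\<And>q. q > N \<Longrightarrow> Vc q = {0}" using dg by (auto simp: dg_module_def)
  obtain s where s: "dg_contraction sg br sv act Vc d s"
    using dg_contraction_exists[OF lie dg exact] by blast
  interpret dg_contraction sg br sv act Vc d s by (rule s)
  have K: "ker_car 0 = range iota" by (simp add: ker_car_def range_iota)
  have "\<exists>alpha. dg_lift sg br sv act Vc d iota X alpha"
  proof -
    define Y where "Y v = X (inv_into UNIV iota v)" for v
    have Y_iota: "Y (iota m) = X m" for m by (simp add: Y_def inj)
    have "Y (sv a (iota m) + iota m') = sg a (Y (iota m)) + Y (iota m')" for a m m'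
    proof -
      have "sv a (iota m) + iota m' = iota (sm a m + m')" using iota_lin by (simp add: lin_on_def)
      then show ?thesis using X_lin by (simp add: Y_iota lin_on_def)
    qed
    then have "lin_on sv sg (ker_car 0) Y" unfolding lin_on_def K by blast
    moreover have "Y (act x v) = br x (Y v)" if "v \<in> ker_car 0" for x v
      using that unfolding K by (auto simp: iota_act[symmetric] Y_iota X_act)
    ultimately obtain alpha where "dg_LP sg br sv act Vc d alpha" "\<forall>v\<in>ker_car 0. alpha0 alpha v = Y v"
      using dg_lift_exists[OF N] by blast
    then show ?thesis by (auto simp: dg_lift_def K Y_iota)
  qed
  moreover have "homotopic sg br sv act Vc d alpha alpha'"
    if "dg_lift sg br sv act Vc d iota X alpha" "dg_lift sg br sv act Vc d iota X alpha'" for alpha alpha'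
  proof -
    have LP: "dg_LP sg br sv act Vc d alpha" "dg_LP sg br sv act Vc d alpha'"
      and al: "alpha0 alpha (iota m) = alpha0 alpha' (iota m)" for m
      using that by (simp_all add: dg_lift_def)
    have om: "omega_map sg sv sg Vc gcar 0 alpha" "omega_map sg sv sg Vc gcar 0 alpha'"
      using LP by (simp_all add: dg_LP_def)
    \<comment> \<open>A lift prescribes only the component at p = q = 0 and the empty list. All
      other components of the image vanish, as both maps have degree 0 and their values are zero on
      lists of the wrong length.\<close>
    have emb: "alpha (emb0 v) = alpha' (emb0 v)" if v: "v \<in> ker_car 0" for v
    proof (intro ext)
      fix p q and xs :: "'g list"
      have o: "emb0 v \<in> Omega sg sv Vc"
        by (rule emb0_Omega[where Wc = Vc, OF vsg V.W.vsubspace_axioms subsetD[OF ker_car_sub v]])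
      have h: "hom_deg 0 (emb0 v)" by (auto simp: hom_deg_def emb0_def fun_eq_iff)
      obtain m where m: "v = iota m" using v K by blast
      show "alpha (emb0 v) p q xs = alpha' (emb0 v) p q xs"
      proof (cases "p = 0 \<and> q = 0 \<and> xs = []")
        case True
        then show ?thesis using al[of m] m by (simp add: alpha0_def)
      next
        case False
        have z: "beta (emb0 v) p q xs = 0" if "omega_map sg sv sg Vc gcar 0 beta" for beta
          using omega_mapD(4)[OF that o h] omega_mapD(1)[OF that o] False
          by (cases "p = 0 \<and> q = 0") (auto simp: hom_deg_def Omega_def alt_map_def)
        show ?thesis using z[OF om(1)] z[OF om(2)] by simp
      qed
    qed
    \<comment> \<open>The power of \<open>proj\<close> moves \<open>c\<close> into \<Omega>(ker
      d_0), where generation by ker d_0 forces the two maps to coincide. Each of them is homotopic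
      to its composite with this power.\<close>
    have "alpha ((proj ^^ Suc N) c) = alpha' ((proj ^^ Suc N) c)" if c: "c \<in> Omega sg sv Vc" for c
      using omega_maps_agree[where ker_car = ker_car, OF B vsg V.W.vsubspace_axioms lie_mod_vsubspace[OF ker_car_lie_mod] ker_car_sub _
          om emb proj_funpow_kernel[OF N c]]
      by (simp add: ker_car_def)
    then have "homotopic sg br sv act Vc d (\<lambda>c. alpha ((proj ^^ Suc N) c)) (\<lambda>c. alpha' ((proj ^^ Suc N) c))"
      by (rule homotopic_agree[OF lie])
    then have "homotopic sg br sv act Vc d (\<lambda>c. alpha ((proj ^^ Suc N) c)) alpha'"
      by (rule homotopic_trans[OF lie _ homotopic_proj_funpow[OF LP(2)]])
    with homotopic_proj_funpow[OF LP(1)] show ?thesis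
      by (rule homotopic_join[OF lie])
  qed
  ultimately show ?thesis by blast
qed

end
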